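(* Let $k\ge2$. Let $H_1,\dots,H_R$ be finite simple (uncolored) graphs, each with at least one edge, let $\alpha_1,\dots,\alpha_R\in\mathbb R_{\ge0}^k$, $\gamma_1,\dots,\gamma_R\ge0$, and $c\in\mathbb R^k$, and for $\mathbf W\in\mathcal W_k$ set $$T(\mathbf W)=t(K_2,\langle c,\mathbf W\rangle)+\sum_{s=1}^R\gamma_s\,t(H_s,\langle\alpha_s,\mathbf W\rangle).$$ Let $\psi_n=\frac1{n^2}\log\sum_{\mathscr X\in\mathcal C_n^k}\exp\{n^2T(\mathbf W^{\mathscr X})\}$. Then $$\lim_{n\to\infty}\psi_n=\sup_{\mu\in\Delta_k}\Big(\langle c,\mu\rangle+\sum_{s=1}^R\gamma_s\langle\alpha_s,\mu\rangle^{|E(H_s)|}-\tfrac12I_k(\mu)\Big),\qquad I_k(\mu)=\sum_{a=1}^k\mu_a\log\mu_a .$$ Moreover, every maximizer of $\mathbf W\mapsto T(\mathbf W)-\frac12\mathcal I(\mathbf W)$ over $k$-colored probability graphons is (almost everywhere) a constant graphon $\mathbf W\equiv\mu^*$, where $\mu^*\in\Delta_k$ attains the supremum on the right-hand side above.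
   Context: Let $[k]=\{1,\dots,k\}$ and $\Delta_k=\{\mu\in[0,1]^k:\sum_a\mu_a=1\}$. A $k$-colored probability graphon is a measurable symmetric map $\mathbf W=(W_1,\dots,W_k):[0,1]^2\to\Delta_k$; $\mathcal W_k$ is the set of these. For $\alpha\in\mathbb R^k$, $\langle\alpha,\mathbf W\rangle(x,y)=\sum_{a=1}^k\alpha_aW_a(x,y)$, and $\langle\alpha,\mu\rangle$ is the usual inner product. For a finite simple graph $H$ and a bounded symmetric measurable $U:[0,1]^2\to\mathbb R$, $$t(H,U)=\int_{[0,1]^{V(H)}}\prod_{(u,v)\in E(H)}U(x_u,x_v)\prod_{v\in V(H)}dx_v ;$$ $K_2$ is a single edge. $\mathcal C_n^k$ is the set of all maps $\mathscr X$ from the edge set of the complete graph $K_n$ on $\{1,\dots,n\}$ to $[k]$. The empirical graphon $\mathbf W^{\mathscr X}\in\mathcal W_k$ has $W^{\mathscr X}_a(x,y)=\mathbf 1\{\mathscr X(\{u,v\})=a\}$ for $(x,y)\in(\frac{u-1}n,\frac un]\times(\frac{v-1}n,\frac vn]$, $u\ne v$, and $\mathbf W^{\mathscr X}=(\frac1k,\dots,\frac1k)$ on the diagonal blocks $u=v$. $\mathcal I(\mathbf W)=\int_{[0,1]^2}I_k(\mathbf W(x,y))\,dx\,dy$, with $0\log 0=0$. *)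

theory Defs
  imports "HOL-Analysis.Analysis" "HOL-Library.Ramsey"
begin

(* The colour set [k] is a finite type 'k with k = CARD('k), so that color vectors live in real ^ 'k
   and the pairing of vectors is the library inner product. *)

definition prob_simplex :: "(real ^ 'k::finite) set" where
  "prob_simplex = {\<mu>. (\<forall>a. 0 \<le> \<mu> $ a \<and> \<mu> $ a \<le> 1) \<and> (\<Sum>a\<in>UNIV. \<mu> $ a) = 1}"

abbreviation unit_lborel :: "real measure" where
  "unit_lborel \<equiv> restrict_space lborel {0..1}"

definition graphons :: "(real \<times> real \<Rightarrow> real ^ 'k::finite) set" where
  "graphons = {W. W \<in> borel_measurable (unit_lborel \<Otimes>\<^sub>M unit_lborel) \<and>
     (\<forall>x\<in>{0..1}. \<forall>y\<in>{0..1}. W (x, y) = W (y, x) \<and> W (x, y) \<in> prob_simplex)}"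

definition simple_graph :: "'v set \<Rightarrow> 'v set set \<Rightarrow> bool" where
  "simple_graph V E \<longleftrightarrow> finite V \<and> E \<subseteq> [V]\<^bsup>2\<^esup>"

(* An edge {u, v} contributes the factor U (x u, x v).  The order on the vertices is only used to
   name the two endpoints; for symmetric U it does not affect the value. *)
definition hom_density :: "'v::linorder set \<Rightarrow> 'v set set \<Rightarrow> (real \<times> real \<Rightarrow> real) \<Rightarrow> real" where
  "hom_density V E U =
     (LINT x|(Pi\<^sub>M V (\<lambda>_. unit_lborel)). (\<Prod>e\<in>E. U (x (Min e), x (Max e))))"

definition edge_density :: "(real \<times> real \<Rightarrow> real) \<Rightarrow> real" where
  "edge_density U = hom_density {0, 1::nat} {{0, 1}} U"

(* ln 0 = 0 in the library, so the convention 0 log 0 = 0 holds. *)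
definition entropy_fun :: "real ^ 'k::finite \<Rightarrow> real" where
  "entropy_fun \<mu> = (\<Sum>a\<in>UNIV. \<mu> $ a * ln (\<mu> $ a))"

definition graphon_entropy :: "(real \<times> real \<Rightarrow> real ^ 'k::finite) \<Rightarrow> real" where
  "graphon_entropy W = (LINT p|(unit_lborel \<Otimes>\<^sub>M unit_lborel). entropy_fun (W p))"

definition colorings :: "nat \<Rightarrow> (nat set \<Rightarrow> 'k::finite) set" where
  "colorings n = [{1..n}]\<^bsup>2\<^esup> \<rightarrow>\<^sub>E UNIV"

(* x lies in ((u - 1) / n, u / n] exactly when u is the ceiling of n * x.  The uniform value is used
   on the diagonal blocks and also on the null set where x = 0 or y = 0, which belongs to no
   block. *)
definition empirical_graphon :: "nat \<Rightarrow> (nat set \<Rightarrow> 'k::finite) \<Rightarrow> real \<times> real \<Rightarrow> real ^ 'k" where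
  "empirical_graphon n X = (\<lambda>(x, y).
     let u = nat \<lceil>real n * x\<rceil>; v = nat \<lceil>real n * y\<rceil> in
       if {u, v} \<in> [{1..n}]\<^bsup>2\<^esup> then (\<chi> a. if X {u, v} = a then 1 else 0)
       else (\<chi> a. 1 / real CARD('k)))"

definition graphon_hamiltonian ::
  "real ^ 'k::finite \<Rightarrow> nat \<Rightarrow> (nat \<Rightarrow> real) \<Rightarrow> (nat \<Rightarrow> real ^ 'k) \<Rightarrow>
   (nat \<Rightarrow> 'v::linorder set) \<Rightarrow> (nat \<Rightarrow> 'v set set) \<Rightarrow> (real \<times> real \<Rightarrow> real ^ 'k) \<Rightarrow> real" where
  "graphon_hamiltonian c R \<gamma> \<alpha> V E W =
     edge_density (\<lambda>p. c \<bullet> W p) +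
     (\<Sum>s=1..R. \<gamma> s * hom_density (V s) (E s) (\<lambda>p. \<alpha> s \<bullet> W p))"

definition free_energy :: "((real \<times> real \<Rightarrow> real ^ 'k::finite) \<Rightarrow> real) \<Rightarrow> nat \<Rightarrow> real" where
  "free_energy T n =
     1 / (real n)\<^sup>2 * ln (\<Sum>X\<in>colorings n. exp ((real n)\<^sup>2 * T (empirical_graphon n X)))"

definition scalar_functional ::
  "real ^ 'k::finite \<Rightarrow> nat \<Rightarrow> (nat \<Rightarrow> real) \<Rightarrow> (nat \<Rightarrow> real ^ 'k) \<Rightarrow>
   (nat \<Rightarrow> 'v set set) \<Rightarrow> real ^ 'k \<Rightarrow> real" where
  "scalar_functional c R \<gamma> \<alpha> E \<mu> =
     c \<bullet> \<mu> + (\<Sum>s=1..R. \<gamma> s * (\<alpha> s \<bullet> \<mu>) ^ card (E s)) - 1 / 2 * entropy_fun \<mu>"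

end

theory Submission
  imports Defs "HOL-Probability.Probability"
begin

text \<open>The arithmetic-geometric mean inequality \<open>\<Prod>\<^sub>e U\<^sub>e \<le> (1 / m) (\<Sum>\<^sub>e U\<^sub>e ^ m)\<close>, integrated over the
  cube, bounds \<open>T W - I W / 2\<close> by the integral of the scalar functional \<open>L\<close> over the values of \<open>W\<close>, hence
  by \<open>sup L\<close>. Equality forces each relevant \<open>\<alpha> s \<bullet> W\<close> to be constant (resample a vertex of one edge
  that is not on another), and \<open>L\<close> is strictly concave on the remaining fibre, so \<open>W\<close> is constant.

  For the limit, the lower bound is the Gibbs inequality for the product measure with marginal \<open>\<mu>\<close>.
  For the upper bound, the greedy weak regularity argument sorts the colourings into \<open>exp (O n)\<close>
  clusters of small diameter in cut norm. On a cluster \<open>T\<close> is nearly constant, equal to its value at the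
  mean graphon \<open>W\<close> of the cluster, and by subadditivity of entropy the logarithm of the size of the
  cluster is at most \<open>- n\<^sup>2 I W / 2\<close>; the bound for graphons applies to \<open>W\<close>.\<close>

section \<open>Entropy on the simplex\<close>

text \<open>The exponent lives on the scale n^2, so factors exp (O n) are free. This shapes the
  upper bound: the number N of rectangles describing a cluster depends on the accuracy \<epsilon>
  only, and N subsets of rows and columns cost O(n) bits. Comparing a cluster with its own mean, not
  with a limit object, keeps the argument at finite n: neither compactness of the space of graphons
  nor a large deviation principle enters. The mean suits both tasks: closeness in cut norm survives
  averaging, and its off-diagonal entries are the marginal colour laws of the uniform distribution
  on the cluster, which is what subadditivity of entropy sees. The factor 1/2 before the entropy
  comes from passing from ordered pairs (the square) to unordered edges. The signs of
  \<open>\<alpha> s\<close> and \<open>\<gamma> s\<close> matter in three places: the factors in the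
  arithmetic-geometric mean inequality, the non-injective vertex maps dropped in the lower bound,
  and the one-sided estimates summed with weights \<open>\<gamma> s\<close>.\<close>

lemma prod_le_one_if_sum_eq_card:
  fixes b :: "'a \<Rightarrow> real"
  assumes "finite E" and nonneg: "\<And>e. e \<in> E \<Longrightarrow> 0 \<le> b e" and sum: "sum b E = card E"
  shows "prod b E \<le> 1" and "prod b E = 1 \<Longrightarrow> e \<in> E \<Longrightarrow> b e = 1"
proof -
  have "prod b E \<le> 1 \<and> (prod b E = 1 \<longrightarrow> (\<forall>e\<in>E. b e = 1))"
  proof (cases "\<exists>e\<in>E. b e = 0")
    case True
    then have "prod b E = 0"
      using \<open>finite E\<close> by (simp add: prod_zero_iff)
    then show ?thesis by simp
  next
    case False
    then have pos: "\<And>e. e \<in> E \<Longrightarrow> 0 < b e"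
      using nonneg by (metis less_eq_real_def)
    have gap: "\<And>e. e \<in> E \<Longrightarrow> 0 \<le> (b e - 1) - ln (b e)"
      using pos ln_le_minus_one by (metis diff_ge_0_iff_ge)
    have ln_prod: "ln (prod b E) = (\<Sum>e\<in>E. ln (b e))"
      using \<open>finite E\<close> by (rule ln_prod) (use pos in fastforce)
    \<comment> \<open>The mean of \<open>b\<close> is 1, so the linear terms cancel. Each summand is
      nonnegative and vanishes only at 1, which settles the inequality and its equality case
      together.\<close>
    have "(\<Sum>e\<in>E. (b e - 1) - ln (b e)) = - ln (prod b E)"
      using sum by (simp add: ln_prod sum_subtractf)
    moreover have "0 \<le> (\<Sum>e\<in>E. (b e - 1) - ln (b e))"
      by (intro sum_nonneg gap)
    ultimately have "ln (prod b E) \<le> 0" and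
      eq: "prod b E = 1 \<Longrightarrow> (\<Sum>e\<in>E. (b e - 1) - ln (b e)) = 0"
      by auto
    moreover have "0 < prod b E"
      using pos by (simp add: prod_pos)
    ultimately have "prod b E \<le> 1"
      by (simp add: ln_le_zero_iff)
    moreover have "b e = 1" if "prod b E = 1" "e \<in> E" for e
    proof -
      have "(b e - 1) - ln (b e) = 0"
        using eq[OF that(1)] gap that(2) \<open>finite E\<close> by (simp add: sum_nonneg_eq_0_iff)
      then show ?thesis
        using pos[OF that(2)] ln_eq_minus_one by force
    qed
    ultimately show ?thesis by blast
  qed
  then show "prod b E \<le> 1" and "prod b E = 1 \<Longrightarrow> e \<in> E \<Longrightarrow> b e = 1"
    by auto
qed

lemma arith_geo_mean_power:
  fixes a :: "'a \<Rightarrow> real"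
  assumes "finite E" "E \<noteq> {}" and nonneg: "\<And>e. e \<in> E \<Longrightarrow> 0 \<le> a e"
  shows "prod a E \<le> (\<Sum>e\<in>E. a e ^ card E) / card E"
    and "prod a E = (\<Sum>e\<in>E. a e ^ card E) / card E \<Longrightarrow> e \<in> E \<Longrightarrow> e' \<in> E \<Longrightarrow> a e = a e'"
proof -
  define m where "m = card E"
  define A where "A = (\<Sum>e\<in>E. a e ^ m) / m"
  have m: "m > 0"
    using assms by (simp add: m_def card_gt_0_iff)
  have A0: "A \<ge> 0"
    unfolding A_def by (intro divide_nonneg_nonneg sum_nonneg) (auto simp: nonneg)
  have "prod a E \<le> A \<and> (prod a E = A \<longrightarrow> (\<forall>e\<in>E. \<forall>e'\<in>E. a e = a e'))"
  proof (cases "A = 0")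
    case True
    then have "(\<Sum>e\<in>E. a e ^ m) = 0"
      using m by (simp add: A_def)
    then have zero: "\<And>e. e \<in> E \<Longrightarrow> a e = 0"
      using \<open>finite E\<close> nonneg m by (subst (asm) sum_nonneg_eq_0_iff) auto
    then have "prod a E = 0"
      using \<open>finite E\<close> \<open>E \<noteq> {}\<close> by (auto simp: prod_zero_iff)
    then show ?thesis
      unfolding \<open>prod a E = 0\<close> True by (simp add: zero)
  next
    case False
    then have A: "A > 0" using A0 by simp
    \<comment> \<open>Normalising the powers to mean 1 reduces to the previous lemma:
      \<open>prod b E\<close> is the m-th power of \<open>prod a E / A\<close>.\<close>
    define b where "b e = a e ^ m / A" for e
    have b: "\<And>e. e \<in> E \<Longrightarrow> 0 \<le> b e"
      using A nonneg by (simp add: b_def)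
    have sb: "sum b E = card E"
      unfolding b_def sum_divide_distrib[symmetric] using A m by (simp add: A_def m_def field_simps)
    have pb: "prod b E = prod a E ^ m / A ^ m"
      by (simp add: b_def prod_dividef prod_power_distrib m_def)
    have "prod a E ^ m \<le> A ^ m"
      using prod_le_one_if_sum_eq_card(1)[OF \<open>finite E\<close> b sb] A by (simp add: pb)
    then have "prod a E \<le> A"
      using m A0 by (meson not_le power_strict_mono)
    moreover have "a e = a e'" if eq: "prod a E = A" and e: "e \<in> E" "e' \<in> E" for e e'
    proof -
      have "prod b E = 1"
        using A by (simp add: pb eq)
      then have "b e = 1" "b e' = 1"
        using prod_le_one_if_sum_eq_card(2)[OF \<open>finite E\<close> b sb] e by auto
      then have "a e ^ m = a e' ^ m"
        using A by (simp add: b_def)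
      then show ?thesis
        using m nonneg e by (simp add: power_eq_iff_eq_base)
    qed
    ultimately show ?thesis by blast
  qed
  then show "prod a E \<le> (\<Sum>e\<in>E. a e ^ card E) / card E"
    and "prod a E = (\<Sum>e\<in>E. a e ^ card E) / card E \<Longrightarrow> e \<in> E \<Longrightarrow> e' \<in> E \<Longrightarrow> a e = a e'"
    unfolding A_def m_def by blast+
qed

text \<open>Nonnegativity of relative entropy in one coordinate; it is
  \<open>ln t \<le> t - 1\<close> at t = y / x. Both the convexity of entropy and the Gibbs
  inequality are sums of it.\<close>

lemma mult_ln_diff_ge:
  fixes x y :: real
  assumes "0 \<le> x" "0 < y"
  shows "x - y \<le> x * ln x - x * ln y" and "x \<noteq> y \<Longrightarrow> x - y < x * ln x - x * ln y"
proof -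
  have "x - y \<le> x * ln x - x * ln y \<and> (x \<noteq> y \<longrightarrow> x - y < x * ln x - x * ln y)"
  proof (cases "x = 0")
    case True
    then show ?thesis using assms by simp
  next
    case False
    then have x: "x > 0" using assms by simp
    have *: "x * ln x - x * ln y = - (x * ln (y / x))"
      using x assms by (simp add: ln_div algebra_simps)
    have le: "ln (y / x) \<le> y / x - 1"
      using x assms by (intro ln_le_minus_one) simp
    then have "x * ln (y / x) \<le> x * (y / x - 1)"
      using x by (intro mult_left_mono) auto
    then have 1: "x * ln (y / x) \<le> y - x"
      using x by (simp add: algebra_simps)
    moreover have "x * ln (y / x) < y - x" if "x \<noteq> y"
    proof -
      have "ln (y / x) \<noteq> y / x - 1"
        using ln_eq_minus_one[of "y / x"] that x assms by (auto simp: field_simps)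
      then have "ln (y / x) < y / x - 1" using le by simp
      then have "x * ln (y / x) < x * (y / x - 1)"
        using x by simp
      then show ?thesis
        using x by (simp add: algebra_simps)
    qed
    ultimately show ?thesis unfolding * by auto
  qed
  then show "x - y \<le> x * ln x - x * ln y" and "x \<noteq> y \<Longrightarrow> x - y < x * ln x - x * ln y"
    by auto
qed

lemma mult_ln_midpoint:
  fixes x y :: real
  assumes "0 \<le> x" "0 \<le> y"
  shows "(x + y) / 2 * ln ((x + y) / 2) \<le> (x * ln x + y * ln y) / 2"
    and "x \<noteq> y \<Longrightarrow> (x + y) / 2 * ln ((x + y) / 2) < (x * ln x + y * ln y) / 2"
proof -
  define m where "m = (x + y) / 2"
  have "m * ln m \<le> (x * ln x + y * ln y) / 2 \<and> (x \<noteq> y \<longrightarrow> m * ln m < (x * ln x + y * ln y) / 2)"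
  proof (cases "m = 0")
    case True
    then have "x = 0" "y = 0" using assms by (auto simp: m_def)
    then show ?thesis using True by simp
  next
    case False
    then have m: "m > 0" using assms by (simp add: m_def)
    have *: "m * ln m = (x * ln m + y * ln m) / 2"
      by (simp add: m_def algebra_simps add_divide_distrib)
    \<comment> \<open>Both endpoints are compared with the tangent at \<open>m\<close>; the
      first-order terms cancel, and strictness at \<open>x\<close> alone is enough.\<close>
    have ds: "(x - m) + (y - m) = 0" by (simp add: m_def field_simps)
    have "x \<noteq> y \<Longrightarrow> x \<noteq> m" by (simp add: m_def field_simps)
    then show ?thesis
      unfolding * using mult_ln_diff_ge[OF assms(1) m] mult_ln_diff_ge(1)[OF assms(2) m] ds
      by (auto simp: algebra_simps)
  qed
  then show "(x + y) / 2 * ln ((x + y) / 2) \<le> (x * ln x + y * ln y) / 2"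
    and "x \<noteq> y \<Longrightarrow> (x + y) / 2 * ln ((x + y) / 2) < (x * ln x + y * ln y) / 2"
    unfolding m_def by auto
qed

text \<open>\<open>r\<close> only has to have mass at most that of \<open>q\<close>. This admits a
  product law restricted to a set of colourings as well as Boltzmann weights; \<open>q\<close> may
  vanish, \<open>r\<close> may not.\<close>

lemma gibbs_inequality:
  fixes q r :: "'a \<Rightarrow> real"
  assumes "\<And>x. x \<in> A \<Longrightarrow> 0 \<le> q x" "\<And>x. x \<in> A \<Longrightarrow> 0 < r x"
    and "sum r A \<le> sum q A"
  shows "(\<Sum>x\<in>A. q x * ln (r x)) \<le> (\<Sum>x\<in>A. q x * ln (q x))"
proof -
  have "(\<Sum>x\<in>A. q x - r x) \<le> (\<Sum>x\<in>A. q x * ln (q x) - q x * ln (r x))"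
    by (intro sum_mono mult_ln_diff_ge assms)
  then show ?thesis
    using assms(3) by (simp add: sum_subtractf)
qed

lemma prob_simplexD:
  assumes "\<mu> \<in> prob_simplex"
  shows "0 \<le> \<mu> $ a" "\<mu> $ a \<le> 1" "(\<Sum>a\<in>UNIV. \<mu> $ a) = 1"
  using assms by (auto simp: prob_simplex_def)

lemma prob_simplexI:
  fixes \<mu> :: "real ^ 'k::finite"
  assumes "\<And>a. 0 \<le> \<mu> $ a" "(\<Sum>a\<in>UNIV. \<mu> $ a) = 1"
  shows "\<mu> \<in> prob_simplex"
proof -
  have "\<mu> $ a \<le> 1" for a
    using assms(2) member_le_sum[of a UNIV "\<lambda>a. \<mu> $ a"] assms(1) by auto
  then show ?thesis using assms by (auto simp: prob_simplex_def)
qed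

lemma uniform_in_prob_simplex: "(\<chi> a. 1 / real CARD('k)) \<in> (prob_simplex :: (real ^ 'k::finite) set)"
  by (intro prob_simplexI) auto

lemma vertex_in_prob_simplex: "(\<chi> a. if b = a then 1 else 0) \<in> (prob_simplex :: (real ^ 'k::finite) set)"
  by (intro prob_simplexI) auto

lemma entropy_fun_bounds:
  fixes \<mu> :: "real ^ 'k::finite"
  assumes "\<mu> \<in> prob_simplex"
  shows "- real CARD('k) \<le> entropy_fun \<mu>" "entropy_fun \<mu> \<le> 0"
proof -
  have "-1 \<le> \<mu> $ a * ln (\<mu> $ a)" for a
    using mult_ln_diff_ge(1)[of "\<mu> $ a" 1] prob_simplexD(1)[OF assms, of a] by auto
  then have "(\<Sum>a\<in>(UNIV::'k set). -1) \<le> entropy_fun \<mu>"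
    unfolding entropy_fun_def by (intro sum_mono)
  then show "- real CARD('k) \<le> entropy_fun \<mu>" by simp
  show "entropy_fun \<mu> \<le> 0"
    unfolding entropy_fun_def
  proof (intro sum_nonpos)
    fix a
    have "ln (\<mu> $ a) \<le> 0"
      using prob_simplexD(1,2)[OF assms, of a] by (cases "\<mu> $ a = 0") (auto simp: ln_le_zero_iff)
    then show "\<mu> $ a * ln (\<mu> $ a) \<le> 0"
      using prob_simplexD(1,2)[OF assms, of a] by (simp add: mult_nonneg_nonpos)
  qed
qed

lemma entropy_fun_midpoint_less:
  assumes "\<mu> \<in> prob_simplex" "\<nu> \<in> prob_simplex" "\<mu> \<noteq> \<nu>"
  shows "entropy_fun ((1 / 2) *\<^sub>R (\<mu> + \<nu>)) < (entropy_fun \<mu> + entropy_fun \<nu>) / 2"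
proof -
  obtain a where a: "\<mu> $ a \<noteq> \<nu> $ a"
    using assms(3) by (auto simp: vec_eq_iff)
  have "entropy_fun ((1 / 2) *\<^sub>R (\<mu> + \<nu>)) =
      (\<Sum>a\<in>UNIV. (\<mu> $ a + \<nu> $ a) / 2 * ln ((\<mu> $ a + \<nu> $ a) / 2))"
    by (simp add: entropy_fun_def)
  also have "\<dots> < (\<Sum>a\<in>UNIV. (\<mu> $ a * ln (\<mu> $ a) + \<nu> $ a * ln (\<nu> $ a)) / 2)"
  proof (rule sum_strict_mono_ex1)
    show "\<forall>a\<in>UNIV. (\<mu> $ a + \<nu> $ a) / 2 * ln ((\<mu> $ a + \<nu> $ a) / 2)
        \<le> (\<mu> $ a * ln (\<mu> $ a) + \<nu> $ a * ln (\<nu> $ a)) / 2"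
      by (intro ballI mult_ln_midpoint(1) prob_simplexD(1) assms)
    show "\<exists>a\<in>UNIV. (\<mu> $ a + \<nu> $ a) / 2 * ln ((\<mu> $ a + \<nu> $ a) / 2)
        < (\<mu> $ a * ln (\<mu> $ a) + \<nu> $ a * ln (\<nu> $ a)) / 2"
      by (intro bexI[of _ a] mult_ln_midpoint(2) prob_simplexD(1) assms a UNIV_I)
  qed simp
  also have "\<dots> = (entropy_fun \<mu> + entropy_fun \<nu>) / 2"
    by (simp add: entropy_fun_def sum.distrib sum_divide_distrib[symmetric] add_divide_distrib)
  finally show ?thesis .
qed

lemma midpoint_in_prob_simplex:
  assumes "\<mu> \<in> prob_simplex" "\<nu> \<in> prob_simplex"
  shows "(1 / 2) *\<^sub>R (\<mu> + \<nu>) \<in> prob_simplex"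
  using prob_simplexD[OF assms(1)] prob_simplexD[OF assms(2)]
  by (intro prob_simplexI) (auto simp: sum_divide_distrib[symmetric] sum.distrib add_nonneg_nonneg)

lemma abs_inner_prob_simplex_le:
  fixes c :: "real ^ 'k::finite"
  assumes "\<mu> \<in> prob_simplex"
  shows "\<bar>c \<bullet> \<mu>\<bar> \<le> (\<Sum>a\<in>UNIV. \<bar>c $ a\<bar>)"
proof -
  have "\<bar>c \<bullet> \<mu>\<bar> \<le> (\<Sum>a\<in>UNIV. \<bar>c $ a * \<mu> $ a\<bar>)"
    unfolding inner_vec_def by (simp add: sum_abs)
  also have "\<dots> \<le> (\<Sum>a\<in>UNIV. \<bar>c $ a\<bar>)"
    using prob_simplexD[OF assms] by (intro sum_mono) (simp add: abs_mult mult_left_le)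
  finally show ?thesis .
qed

lemma inner_prob_simplex_nonneg:
  fixes \<alpha> :: "real ^ 'k::finite"
  assumes "\<mu> \<in> prob_simplex" "\<And>a. 0 \<le> \<alpha> $ a"
  shows "0 \<le> \<alpha> \<bullet> \<mu>"
  using prob_simplexD[OF assms(1)] assms(2) by (auto simp: inner_vec_def intro!: sum_nonneg)

text \<open>Gives the real-valued supremum its meaning: only with this bound is every value below
  it.\<close>

lemma bdd_above_scalar_functional:
  fixes c :: "real ^ 'k::finite"
  shows "bdd_above (scalar_functional c R \<gamma> \<alpha> E ` prob_simplex)"
proof (rule bdd_aboveI2)
  fix \<mu> :: "real ^ 'k" assume \<mu>: "\<mu> \<in> prob_simplex"
  have "\<gamma> s * (\<alpha> s \<bullet> \<mu>) ^ card (E s) \<le> \<bar>\<gamma> s\<bar> * (\<Sum>a\<in>UNIV. \<bar>\<alpha> s $ a\<bar>) ^ card (E s)" for s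
  proof -
    have "\<gamma> s * (\<alpha> s \<bullet> \<mu>) ^ card (E s) \<le> \<bar>\<gamma> s\<bar> * \<bar>\<alpha> s \<bullet> \<mu>\<bar> ^ card (E s)"
      by (metis abs_ge_self abs_mult power_abs)
    also have "\<dots> \<le> \<bar>\<gamma> s\<bar> * (\<Sum>a\<in>UNIV. \<bar>\<alpha> s $ a\<bar>) ^ card (E s)"
      by (intro mult_left_mono power_mono abs_inner_prob_simplex_le \<mu>) auto
    finally show ?thesis .
  qed
  then have "(\<Sum>s=1..R. \<gamma> s * (\<alpha> s \<bullet> \<mu>) ^ card (E s))
      \<le> (\<Sum>s=1..R. \<bar>\<gamma> s\<bar> * (\<Sum>a\<in>UNIV. \<bar>\<alpha> s $ a\<bar>) ^ card (E s))"
    by (intro sum_mono)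
  then show "scalar_functional c R \<gamma> \<alpha> E \<mu> \<le> (\<Sum>a\<in>UNIV. \<bar>c $ a\<bar>)
      + (\<Sum>s=1..R. \<bar>\<gamma> s\<bar> * (\<Sum>a\<in>UNIV. \<bar>\<alpha> s $ a\<bar>) ^ card (E s)) + real CARD('k) / 2"
    using abs_inner_prob_simplex_le[OF \<mu>, of c] entropy_fun_bounds(1)[OF \<mu>]
    unfolding scalar_functional_def by linarith
qed

lemma scalar_functional_le_SUP:
  "\<mu> \<in> prob_simplex \<Longrightarrow>
    scalar_functional c R \<gamma> \<alpha> E \<mu> \<le> (SUP \<nu>\<in>prob_simplex. scalar_functional c R \<gamma> \<alpha> E \<nu>)"
  by (rule cSUP_upper[OF _ bdd_above_scalar_functional])

section \<open>Homomorphism densities and edge moments\<close>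

text \<open>It suffices to test rectangles, and the preimage of a rectangle is a cylinder over the
  two distinct coordinates \<open>u\<close>, \<open>v\<close>.\<close>

lemma distr_PiM_pair:
  assumes M: "prob_space M" and uv: "u \<in> V" "v \<in> V" "u \<noteq> v"
  shows "distr (Pi\<^sub>M V (\<lambda>_. M)) (M \<Otimes>\<^sub>M M) (\<lambda>x. (x u, x v)) = M \<Otimes>\<^sub>M M"
proof (rule pair_measure_eqI[symmetric])
  interpret M: prob_space M by fact
  show "sigma_finite_measure M" "sigma_finite_measure M" ..
  fix A B assume AB: "A \<in> sets M" "B \<in> sets M"
  let ?X = "\<lambda>i. if i = u then A else B"
  have "(\<lambda>x. (x u, x v)) -` (A \<times> B) \<inter> space (Pi\<^sub>M V (\<lambda>_. M)) =
      prod_emb V (\<lambda>_. M) {u, v} (Pi\<^sub>E {u, v} ?X)"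
    using uv by (auto simp: prod_emb_def space_PiM PiE_iff)
  then have "emeasure (distr (Pi\<^sub>M V (\<lambda>_. M)) (M \<Otimes>\<^sub>M M) (\<lambda>x. (x u, x v))) (A \<times> B) =
      emeasure (Pi\<^sub>M V (\<lambda>_. M)) (prod_emb V (\<lambda>_. M) {u, v} (Pi\<^sub>E {u, v} ?X))"
    using uv AB by (subst emeasure_distr) auto
  also have "\<dots> = (\<Prod>i\<in>{u, v}. emeasure M (?X i))"
    using uv AB M by (intro emeasure_PiM_emb) auto
  also have "\<dots> = emeasure M A * emeasure M B"
    using uv by simp
  finally show "emeasure M A * emeasure M B =
      emeasure (distr (Pi\<^sub>M V (\<lambda>_. M)) (M \<Otimes>\<^sub>M M) (\<lambda>x. (x u, x v))) (A \<times> B)" by simp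
qed simp

lemma prob_space_unit_lborel: "prob_space unit_lborel"
  by (rule prob_spaceI) (simp add: emeasure_restrict_space space_restrict_space)

interpretation unit: prob_space unit_lborel
  by (rule prob_space_unit_lborel)

interpretation unit2: pair_prob_space unit_lborel unit_lborel ..

abbreviation (input) unit_square :: "(real \<times> real) measure" where
  "unit_square \<equiv> unit_lborel \<Otimes>\<^sub>M unit_lborel"

lemma space_unit_square: "space unit_square = {0..1} \<times> {0..1}"
  by (simp add: space_pair_measure space_restrict_space)

lemma prob_space_unit_cube: "prob_space (Pi\<^sub>M V (\<lambda>_. unit_lborel))"
  by (intro prob_space_PiM prob_space_unit_lborel)

lemma (in prob_space) integrable_bounded:
  fixes f :: "_ \<Rightarrow> real"
  assumes "f \<in> borel_measurable M" "\<And>x. x \<in> space M \<Longrightarrow> \<bar>f x\<bar> \<le> B"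
  shows "integrable M f"
  using assms by (intro integrable_const_bound[of _ B]) auto

lemma simple_graphD:
  assumes "simple_graph V E"
  shows "finite V" "finite E"
    and "e \<in> E \<Longrightarrow> Min e \<in> V" "e \<in> E \<Longrightarrow> Max e \<in> V" "e \<in> E \<Longrightarrow> Min e \<noteq> Max e"
    and "e \<in> E \<Longrightarrow> e = {Min e, Max e}"
proof -
  show "finite V" "finite E"
    using assms finite_imp_finite_nsets finite_subset by (auto simp: simple_graph_def)
  have *: "Min e \<in> V \<and> Max e \<in> V \<and> Min e \<noteq> Max e \<and> e = {Min e, Max e}" if "e \<in> E"
  proof -
    have "e \<in> [V]\<^bsup>2\<^esup>" using assms that by (auto simp: simple_graph_def)
    then obtain u v where "e = {u, v}" "u \<in> V" "v \<in> V" "u \<noteq> v"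
      by (auto simp: nsets_2_eq)
    then show ?thesis by (cases u v rule: linorder_cases) (auto simp: min_def max_def)
  qed
  then show "e \<in> E \<Longrightarrow> Min e \<in> V" "e \<in> E \<Longrightarrow> Max e \<in> V" "e \<in> E \<Longrightarrow> Min e \<noteq> Max e"
    "e \<in> E \<Longrightarrow> e = {Min e, Max e}" by auto
qed

lemma measurable_edge:
  assumes "u \<in> V" "v \<in> V"
  shows "(\<lambda>x. (x u, x v)) \<in> measurable (Pi\<^sub>M V (\<lambda>_. M)) (M \<Otimes>\<^sub>M M)"
  using assms by measurable

lemma integral_edge:
  fixes f :: "_ \<Rightarrow> real"
  assumes "prob_space M" "u \<in> V" "v \<in> V" "u \<noteq> v" "f \<in> borel_measurable (M \<Otimes>\<^sub>M M)"
  shows "(LINT x|Pi\<^sub>M V (\<lambda>_. M). f (x u, x v)) = integral\<^sup>L (M \<Otimes>\<^sub>M M) f"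
  using integral_distr[OF measurable_edge[OF assms(2,3), of M] assms(5)] distr_PiM_pair[OF assms(1-4)]
  by simp

lemma edge_density_eq:
  assumes "f \<in> borel_measurable unit_square"
  shows "edge_density f = integral\<^sup>L unit_square f"
  using integral_edge[OF prob_space_unit_lborel, of 0 "{0, 1::nat}" 1] assms
  by (simp add: edge_density_def hom_density_def)

section \<open>The arithmetic-geometric mean bound for densities, and its equality case\<close>

context
  fixes V :: "'v::linorder set" and E and U :: "real \<times> real \<Rightarrow> real" and B :: real
  assumes G: "simple_graph V E" "E \<noteq> {}"
    and U: "U \<in> borel_measurable unit_square"
    and U0: "\<And>p. p \<in> space unit_square \<Longrightarrow> 0 \<le> U p" and UB: "\<And>p. p \<in> space unit_square \<Longrightarrow> U p \<le> B"
begin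

private abbreviation (input) cube where "cube \<equiv> Pi\<^sub>M V (\<lambda>_. unit_lborel)"

private lemma edge_in_square:
  "x \<in> space cube \<Longrightarrow> e \<in> E \<Longrightarrow> (x (Min e), x (Max e)) \<in> space unit_square"
  using simple_graphD(3-5)[OF G(1)] by (auto simp: space_PiM space_pair_measure PiE_iff)

private lemma U_edge_measurable [measurable]:
  "e \<in> E \<Longrightarrow> (\<lambda>x. U (x (Min e), x (Max e))) \<in> borel_measurable cube"
  by (intro measurable_compose[OF measurable_edge U] simple_graphD(3,4)[OF G(1)])

private lemma integrable_prod_edges:
  "integrable cube (\<lambda>x. \<Prod>e\<in>E. U (x (Min e), x (Max e)))"
proof (rule prob_space.integrable_bounded[OF prob_space_unit_cube])
  show "(\<lambda>x. \<Prod>e\<in>E. U (x (Min e), x (Max e))) \<in> borel_measurable cube"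
    by (intro borel_measurable_prod U_edge_measurable)
  fix x assume x: "x \<in> space cube"
  have "\<bar>\<Prod>e\<in>E. U (x (Min e), x (Max e))\<bar> = (\<Prod>e\<in>E. U (x (Min e), x (Max e)))"
    using U0 edge_in_square[OF x] by (intro abs_of_nonneg prod_nonneg) auto
  also have "\<dots> \<le> (\<Prod>e\<in>E. B)"
    using U0 UB edge_in_square[OF x] by (intro prod_mono) auto
  finally show "\<bar>\<Prod>e\<in>E. U (x (Min e), x (Max e))\<bar> \<le> (\<Prod>e\<in>E. B)" .
qed

private lemma integrable_edge_power:
  assumes "e \<in> E"
  shows "integrable cube (\<lambda>x. U (x (Min e), x (Max e)) ^ n)"
proof (rule prob_space.integrable_bounded[OF prob_space_unit_cube])
  show "(\<lambda>x. U (x (Min e), x (Max e)) ^ n) \<in> borel_measurable cube"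
    using U_edge_measurable[OF assms] by measurable
  show "\<bar>U (x (Min e), x (Max e)) ^ n\<bar> \<le> B ^ n" if "x \<in> space cube" for x
    using U0 UB edge_in_square[OF that assms] by (simp add: power_abs abs_of_nonneg power_mono)
qed

private lemma integrable_power_mean:
  "integrable cube (\<lambda>x. (\<Sum>e\<in>E. U (x (Min e), x (Max e)) ^ card E) / card E)"
  by (intro integrable_divide Bochner_Integration.integrable_sum integrable_edge_power)

text \<open>Every edge sees the same pair law, so each of the \<open>card E\<close> summands
  integrates to the same moment and the average removes the count.\<close>

private lemma integral_power_mean:
  "(LINT x|cube. (\<Sum>e\<in>E. U (x (Min e), x (Max e)) ^ card E) / card E) = (LINT p|unit_square. U p ^ card E)"
proof -
  have "(LINT x|cube. (\<Sum>e\<in>E. U (x (Min e), x (Max e)) ^ card E)) =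
      (\<Sum>e\<in>E. LINT x|cube. U (x (Min e), x (Max e)) ^ card E)"
    by (intro Bochner_Integration.integral_sum integrable_edge_power)
  also have "\<dots> = (\<Sum>e\<in>E. LINT p|unit_square. U p ^ card E)"
    using U by (intro sum.cong integral_edge[OF prob_space_unit_lborel] simple_graphD(3-5)[OF G(1)] refl) auto
  finally show ?thesis
    using G(2) simple_graphD(2)[OF G(1)] by simp
qed

lemma hom_density_le_integral_power:
  "hom_density V E U \<le> (LINT p|unit_square. U p ^ card E)"
  unfolding hom_density_def integral_power_mean[symmetric]
  using simple_graphD(2)[OF G(1)] G(2) U0 edge_in_square
  by (intro integral_mono integrable_prod_edges integrable_power_mean arith_geo_mean_power) auto

text \<open>The pointwise defect of the mean inequality is nonnegative with integral 0, hence
  vanishes almost everywhere, and the pointwise equality case applies.\<close>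

lemma hom_density_eq_imp_edges_equal:
  assumes "hom_density V E U = (LINT p|unit_square. U p ^ card E)"
  shows "AE x in Pi\<^sub>M V (\<lambda>_. unit_lborel). \<forall>e\<in>E. \<forall>e'\<in>E. U (x (Min e), x (Max e)) = U (x (Min e'), x (Max e'))"
proof -
  let ?f = "\<lambda>x. \<Prod>e\<in>E. U (x (Min e), x (Max e))"
  let ?g = "\<lambda>x. (\<Sum>e\<in>E. U (x (Min e), x (Max e)) ^ card E) / card E"
  note E = simple_graphD(2)[OF G(1)] G(2)
  have int: "integrable cube ?f" "integrable cube ?g"
    by (intro integrable_prod_edges integrable_power_mean)+
  have le: "?f x \<le> ?g x" if "x \<in> space cube" for x
    using E U0 edge_in_square[OF that] by (intro arith_geo_mean_power) auto
  have "(LINT x|cube. ?g x - ?f x) = 0"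
    unfolding Bochner_Integration.integral_diff[OF int(2,1)] integral_power_mean
    using assms by (simp add: hom_density_def)
  then have "AE x in cube. ?g x - ?f x = 0"
    using int le by (subst (asm) integral_nonneg_eq_0_iff_AE) (auto intro!: AE_I2)
  then show ?thesis
    using AE_space
  proof eventually_elim
    case (elim x)
    then have "?f x = ?g x" by simp
    then show ?case
      using E U0 edge_in_square[OF elim(2)]
        arith_geo_mean_power(2)[of E "\<lambda>e. U (x (Min e), x (Max e))"] by blast
  qed
qed

text \<open>With v in e' but not in e, the common value of the two edges cannot depend on the
  coordinate of v. Hence \<open>U (x, y)\<close> is a function of x alone, and by symmetry of y
  alone.\<close>

lemma hom_density_eq_imp_const:
  assumes eq: "hom_density V E U = (LINT p|unit_square. U p ^ card E)"
    and sym: "\<And>x y. x \<in> {0..1} \<Longrightarrow> y \<in> {0..1} \<Longrightarrow> U (x, y) = U (y, x)"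
    and "card E \<ge> 2"
  shows "\<exists>\<kappa>. AE p in unit_square. U p = \<kappa>"
proof -
  note [measurable] = U
  obtain e e' where e: "e \<in> E" "e' \<in> E" "e \<noteq> e'"
    using \<open>card E \<ge> 2\<close> by (metis card_2_iff' ex_card subsetD)
  note e_eq = simple_graphD(6)[OF G(1) e(1)] simple_graphD(6)[OF G(1) e(2)]
  \<comment> \<open>Distinct edges have equal size, so e' has an endpoint v outside e; the other
    endpoint w may lie on e.\<close>
  obtain v w where vw: "e' = {v, w}" "v \<notin> e" "v \<noteq> w" "v \<in> V" "w \<in> V"
  proof (cases "Min e' \<in> e")
    case True
    then have "Max e' \<notin> e"
      using e_eq e(3) simple_graphD(5)[OF G(1) e(2)] by (metis doubleton_eq_iff insertE singletonD)
    then show ?thesis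
      using e_eq(2) simple_graphD(3-5)[OF G(1) e(2)] by (intro that[of "Max e'" "Min e'"]) auto
  next
    case False
    then show ?thesis
      using e_eq(2) simple_graphD(3-5)[OF G(1) e(2)] by (intro that[of "Min e'" "Max e'"]) auto
  qed
  define I where "I = V - {v}"
  have V: "V = insert v I" using vw by (auto simp: I_def)
  have finI: "finite I" using simple_graphD(1)[OF G(1)] by (simp add: I_def)
  have wI: "w \<in> I" using vw by (simp add: I_def)
  have eI: "Min e \<in> I" "Max e \<in> I"
    using simple_graphD(3,4)[OF G(1) e(1)] e_eq(1) vw(2) by (metis DiffI I_def insertCI singletonD)+
  let ?N = "Pi\<^sub>M I (\<lambda>_. unit_lborel)"
  interpret N: prob_space ?N by (rule prob_space_unit_cube)
  interpret NM: pair_prob_space unit_lborel ?N ..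
  interpret MN: pair_prob_space ?N unit_lborel ..
  define Ue where "Ue z = U (z (Min e), z (Max e))" for z
  have Ue_meas [measurable]: "Ue \<in> borel_measurable ?N"
    using measurable_compose[OF measurable_edge[OF eI] U] by (simp add: Ue_def[abs_def])
  have zw [measurable]: "(\<lambda>z. z w) \<in> measurable ?N unit_lborel"
    using wI by measurable
  have upd: "(\<lambda>(y, z). z(v := y)) \<in> measurable (unit_lborel \<Otimes>\<^sub>M ?N) cube"
    unfolding V case_prod_beta by (rule measurable_fun_upd[where J = I]) auto
  \<comment> \<open>The coordinate at v is split off as an independent factor, so that it can be
    varied while the others stay fixed.\<close>
  have distr_upd: "distr (unit_lborel \<Otimes>\<^sub>M ?N) cube (\<lambda>(y, z). z(v := y)) = cube"
    unfolding V by (rule distr_pair_PiM_eq_PiM) (rule prob_space_unit_lborel)+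
  have "AE x in cube. Ue x = U (x w, x v)"
    using hom_density_eq_imp_edges_equal[OF eq] AE_space
  proof eventually_elim
    case (elim x)
    have "x v \<in> {0..1}" "x w \<in> {0..1}"
      using elim(2) vw by (auto simp: space_PiM space_restrict_space)
    moreover have "(Min e' = v \<and> Max e' = w) \<or> (Min e' = w \<and> Max e' = v)"
      using e_eq(2) vw by (metis doubleton_eq_iff)
    ultimately show ?case
      using elim(1) e sym unfolding Ue_def by fastforce
  qed
  then have "AE x in distr (unit_lborel \<Otimes>\<^sub>M ?N) cube (\<lambda>(y, z). z(v := y)). Ue x = U (x w, x v)"
    unfolding distr_upd .
  then have "AE p in unit_lborel \<Otimes>\<^sub>M ?N.
      Ue (case p of (y, z) \<Rightarrow> z(v := y)) = U ((case p of (y, z) \<Rightarrow> z(v := y)) w, (case p of (y, z) \<Rightarrow> z(v := y)) v)"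
    by (rule AE_distrD[OF upd])
  then have "AE p in unit_lborel \<Otimes>\<^sub>M ?N. Ue (snd p) = U (snd p w, fst p)"
  proof eventually_elim
    case (elim p)
    have "Ue ((snd p)(v := fst p)) = Ue (snd p)"
      using eI by (auto simp: Ue_def I_def)
    then show ?case using elim vw(3) by (simp add: case_prod_beta)
  qed
  then have "AE y in unit_lborel. AE z in ?N. Ue z = U (z w, y)"
    by (auto dest: NM.AE_pair)
  then have *: "AE z in ?N. AE y in unit_lborel. Ue z = U (z w, y)"
    by (subst MN.AE_commute) measurable
  \<comment> \<open>For almost all z, \<open>U (z w, y)\<close> equals the constant
    \<open>Ue z\<close> for almost every y, hence equals its own mean over y. So the value depends
    on z only through \<open>z w\<close>.\<close>
  define g where "g a = (LINT y|unit_lborel. U (a, y))" for a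
  have g_meas [measurable]: "g \<in> borel_measurable unit_lborel"
    unfolding g_def by measurable
  have "AE z in ?N. AE y in unit_lborel. U (z w, y) = g (z w)"
    using * AE_space
  proof eventually_elim
    case (elim z)
    then have "z w \<in> space unit_lborel" using wI by (auto simp: space_PiM)
    then have "(\<lambda>y. U (z w, y)) \<in> borel_measurable unit_lborel" by measurable
    then have "g (z w) = (LINT y|unit_lborel. Ue z)"
      unfolding g_def using elim(1) by (intro integral_cong_AE) auto
    then have "g (z w) = Ue z" using unit.prob_space by simp
    then show ?case using elim(1) by auto
  qed
  then have "AE y in unit_lborel. AE z in ?N. U (z w, y) = g (z w)"
    by (subst NM.AE_commute) measurable
  then have "AE p in unit_lborel \<Otimes>\<^sub>M ?N. U (snd p w, fst p) = g (snd p w)"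
    by (intro NM.AE_pair_measure) auto
  then have "AE p in unit_lborel \<Otimes>\<^sub>M ?N.
      (\<lambda>x. U (x w, x v) = g (x w)) (case p of (y, z) \<Rightarrow> z(v := y))"
    using vw(3) by (auto simp: case_prod_beta)
  then have "AE x in cube. U (x w, x v) = g (x w)"
    by (subst distr_upd[symmetric], subst AE_distr_iff[OF upd])
       (use vw(4,5) in measurable)
  then have "AE x in cube. (\<lambda>p. U p = g (fst p)) (x w, x v)"
    by simp
  \<comment> \<open>The identity involves the coordinates w and v only, whose joint law is uniform
    on the square.\<close>
  then have "AE p in distr cube unit_square (\<lambda>x. (x w, x v)). U p = g (fst p)"
    using vw by (subst AE_distr_iff) (auto intro: measurable_edge)
  then have 1: "AE p in unit_square. U p = g (fst p)"
    unfolding distr_PiM_pair[OF prob_space_unit_lborel vw(5,4) vw(3)[symmetric]] .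
  then have "AE x in unit_lborel. AE y in unit_lborel. U (x, y) = g x"
    by (auto dest: unit2.AE_pair)
  then have "AE y in unit_lborel. AE x in unit_lborel. U (x, y) = g x"
    by (subst unit2.AE_commute[symmetric]) measurable
  then have 2: "AE y in unit_lborel. AE x in unit_lborel. U (y, x) = g x"
    using AE_space
  proof eventually_elim
    case (elim y)
    from elim(1) AE_space show ?case
      by eventually_elim (use elim(2) sym in \<open>auto simp: space_restrict_space\<close>)
  qed
  have "AE x in unit_lborel. AE y in unit_lborel. g y = g x"
    using 2 unit2.AE_pair[OF 1]
  proof eventually_elim
    case (elim x)
    then show ?case by eventually_elim simp
  qed
  \<comment> \<open>A property holding almost everywhere in a probability space holds somewhere; the
    value of \<open>g\<close> at such a point is the constant.\<close>
  then obtain x where x: "AE y in unit_lborel. g y = g x"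
    using eventually_happens' unit.ae_filter_bot by blast
  have "AE y in unit_lborel. AE z in unit_lborel. U (y, z) = g x"
    using 2
  proof eventually_elim
    case (elim y)
    then show ?case using x by eventually_elim simp
  qed
  then have "AE p in unit_square. U p = g x"
    by (intro unit2.AE_pair_measure) auto
  then show ?thesis by blast
qed

end

lemma graphons_measurable:
  fixes W :: "real \<times> real \<Rightarrow> real ^ 'k::finite"
  assumes "W \<in> graphons"
  shows "(\<lambda>p. \<alpha> \<bullet> W p) \<in> borel_measurable unit_square"
    and "(\<lambda>p. entropy_fun (W p)) \<in> borel_measurable unit_square"
proof -
  have W: "W \<in> borel_measurable unit_square"
    using assms by (simp add: graphons_def)
  show inner: "(\<lambda>p. \<alpha> \<bullet> W p) \<in> borel_measurable unit_square" for \<alpha>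
    using W by measurable
  have [measurable]: "(\<lambda>p. W p $ a) \<in> borel_measurable unit_square" for a
    using inner[of "axis a 1"] by (simp add: inner_axis')
  show "(\<lambda>p. entropy_fun (W p)) \<in> borel_measurable unit_square"
    unfolding entropy_fun_def by measurable
qed

lemma graphons_in_prob_simplex:
  "W \<in> graphons \<Longrightarrow> p \<in> space unit_square \<Longrightarrow> W p \<in> prob_simplex"
  by (auto simp: graphons_def space_unit_square)

lemma graphons_sym:
  "W \<in> graphons \<Longrightarrow> x \<in> {0..1} \<Longrightarrow> y \<in> {0..1} \<Longrightarrow> W (x, y) = W (y, x)"
  by (auto simp: graphons_def)

lemma const_in_graphons: "\<mu> \<in> prob_simplex \<Longrightarrow> (\<lambda>_. \<mu>) \<in> graphons"
  by (simp add: graphons_def)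

lemma graphons_integrable:
  fixes W :: "real \<times> real \<Rightarrow> real ^ 'k::finite"
  assumes "W \<in> graphons"
  shows "integrable unit_square (\<lambda>p. \<alpha> \<bullet> W p)"
    and "integrable unit_square (\<lambda>p. (\<alpha> \<bullet> W p) ^ m)"
    and "integrable unit_square (\<lambda>p. entropy_fun (W p))"
proof -
  note [measurable] = graphons_measurable[OF assms]
  note simplex = graphons_in_prob_simplex[OF assms]
  show "integrable unit_square (\<lambda>p. (\<alpha> \<bullet> W p) ^ m)" for m
  proof (rule unit2.integrable_bounded)
    show "\<bar>(\<alpha> \<bullet> W p) ^ m\<bar> \<le> (\<Sum>a\<in>UNIV. \<bar>\<alpha> $ a\<bar>) ^ m" if "p \<in> space unit_square" for p
      using abs_inner_prob_simplex_le[OF simplex[OF that]] by (simp add: power_abs power_mono)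
  qed measurable
  from this[of 1] show "integrable unit_square (\<lambda>p. \<alpha> \<bullet> W p)" by simp
  show "integrable unit_square (\<lambda>p. entropy_fun (W p))"
  proof (rule unit2.integrable_bounded)
    show "\<bar>entropy_fun (W p)\<bar> \<le> real CARD('k)" if "p \<in> space unit_square" for p
      using entropy_fun_bounds[OF simplex[OF that]] by simp
  qed measurable
qed

lemma hom_density_graphon:
  fixes W :: "real \<times> real \<Rightarrow> real ^ 'k::finite" and V :: "'v::linorder set"
  assumes "W \<in> graphons" "simple_graph V E" "E \<noteq> {}" "\<And>a. 0 \<le> \<alpha> $ a"
  shows "hom_density V E (\<lambda>p. \<alpha> \<bullet> W p) \<le> (LINT p|unit_square. (\<alpha> \<bullet> W p) ^ card E)"
    and "hom_density V E (\<lambda>p. \<alpha> \<bullet> W p) = (LINT p|unit_square. (\<alpha> \<bullet> W p) ^ card E) \<Longrightarrow> card E \<ge> 2 \<Longrightarrow>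
      \<exists>\<kappa>. AE p in unit_square. \<alpha> \<bullet> W p = \<kappa>"
proof -
  have bounds: "0 \<le> \<alpha> \<bullet> W p" "\<alpha> \<bullet> W p \<le> (\<Sum>a\<in>UNIV. \<bar>\<alpha> $ a\<bar>)" if "p \<in> space unit_square" for p
    using inner_prob_simplex_nonneg[OF graphons_in_prob_simplex[OF assms(1) that] assms(4)]
      abs_inner_prob_simplex_le[OF graphons_in_prob_simplex[OF assms(1) that], of \<alpha>] by auto
  note * = assms(2,3) graphons_measurable(1)[OF assms(1)] bounds
  show "hom_density V E (\<lambda>p. \<alpha> \<bullet> W p) \<le> (LINT p|unit_square. (\<alpha> \<bullet> W p) ^ card E)"
    by (rule hom_density_le_integral_power[OF *])
  show "hom_density V E (\<lambda>p. \<alpha> \<bullet> W p) = (LINT p|unit_square. (\<alpha> \<bullet> W p) ^ card E) \<Longrightarrow> card E \<ge> 2 \<Longrightarrow>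
      \<exists>\<kappa>. AE p in unit_square. \<alpha> \<bullet> W p = \<kappa>"
    using graphons_sym[OF assms(1)] by (intro hom_density_eq_imp_const[OF *]) auto
qed

lemma hom_density_const:
  fixes V :: "'v::linorder set"
  assumes "finite V"
  shows "hom_density V E (\<lambda>_. u) = u ^ card E"
proof -
  interpret prob_space "Pi\<^sub>M V (\<lambda>_. unit_lborel)" by (rule prob_space_unit_cube)
  show ?thesis unfolding hom_density_def using prob_space by simp
qed

section \<open>Step graphons\<close>

text \<open>Blocks are open on the left, so for positive \<open>n\<close> the index 0 occurs in the
  unit interval only at x = 0, a null set.\<close>

definition block_index :: "nat \<Rightarrow> real \<Rightarrow> nat" where
  "block_index n x = nat \<lceil>real n * x\<rceil>"

text \<open>The value type stays open so that colour vectors, their inner products and their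
  entropies are all handled by one construction.\<close>

definition step_graphon :: "nat \<Rightarrow> (nat \<Rightarrow> nat \<Rightarrow> 'a) \<Rightarrow> real \<times> real \<Rightarrow> 'a" where
  "step_graphon n w = (\<lambda>(x, y). w (block_index n x) (block_index n y))"

lemma block_index_measurable [measurable]: "block_index n \<in> measurable unit_lborel (count_space UNIV)"
proof -
  have "block_index n \<in> measurable borel (count_space UNIV)"
    unfolding block_index_def by measurable
  then show ?thesis
    by (intro measurable_restrict_space1) simp
qed

lemma block_index_le: "x \<in> {0..1} \<Longrightarrow> block_index n x \<le> n"
  unfolding block_index_def by (simp add: ceiling_le_iff mult_left_le)

lemma integral_block_index_eq:
  assumes "n > 0" "j \<le> n"
  shows "(LINT x|unit_lborel. of_bool (block_index n x = j)) = (if j = 0 then 0 else 1 / real n)"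
proof -
  let ?A = "if j = 0 then {0} else {(real j - 1) / n <.. real j / n}"
  have eq: "block_index n x = j \<longleftrightarrow> x \<in> ?A" if "x \<in> {0..1}" for x
  proof (cases "j = 0")
    case True
    then show ?thesis
      using that \<open>n > 0\<close> by (auto simp: block_index_def ceiling_le_iff mult_le_0_iff)
  next
    case False
    then have "block_index n x = j \<longleftrightarrow> \<lceil>real n * x\<rceil> = int j"
      by (auto simp: block_index_def)
    also have "\<dots> \<longleftrightarrow> x \<in> ?A"
      using False \<open>n > 0\<close> by (auto simp: ceiling_eq_iff field_simps)
    finally show ?thesis .
  qed
  have sub: "?A \<subseteq> {0..1}"
  proof (cases "j = 0")
    case False
    then have "0 \<le> (real j - 1) / real n" by (intro divide_nonneg_nonneg) auto
    moreover have "real j / real n \<le> 1" using assms by simp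
    ultimately have "{(real j - 1) / real n <.. real j / real n} \<subseteq> {0..1}"
      by (meson atLeastAtMost_iff greaterThanAtMost_iff less_imp_le order_trans subsetI)
    then show ?thesis using False by simp
  qed simp
  have "(LINT x|unit_lborel. of_bool (block_index n x = j)) = (LINT x|unit_lborel. indicator ?A x :: real)"
    by (intro Bochner_Integration.integral_cong refl) (simp only: space_restrict_space indicator_def, use eq in auto)
  also have "\<dots> = measure unit_lborel ?A"
    using sub by (subst Bochner_Integration.integral_indicator) (auto simp: space_restrict_space Int_absorb1 Int_absorb2)
  also have "\<dots> = measure lborel ?A"
    using sub by (intro measure_restrict_space) auto
  also have "\<dots> = (if j = 0 then 0 else 1 / real n)"
    using assms by (simp add: divide_right_mono field_simps)
  finally show ?thesis .
qed

text \<open>\<open>F\<close> is expanded over indicators of index vectors, whose integrals factor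
  over the coordinates. The expansion must start with indices in {0..n}; vectors containing 0 then
  carry measure 0.\<close>

lemma integral_cube_block_index:
  fixes F :: "('v \<Rightarrow> nat) \<Rightarrow> real"
  assumes "finite V" "n > 0"
  shows "(LINT x|Pi\<^sub>M V (\<lambda>_. unit_lborel). F (\<lambda>v\<in>V. block_index n (x v)))
    = (\<Sum>z\<in>V \<rightarrow>\<^sub>E {1..n}. F z) / real n ^ card V"
proof -
  let ?M = "Pi\<^sub>M V (\<lambda>_. unit_lborel)"
  interpret product_prob_space "\<lambda>_. unit_lborel" V ..
  let ?Z = "V \<rightarrow>\<^sub>E {0..n}"
  have fin: "finite ?Z" using assms by (simp add: finite_PiE)
  have int1: "integrable unit_lborel (\<lambda>y. of_bool (block_index n y = j) :: real)" for j
    by (rule unit.integrable_bounded[of _ 1]) (auto intro!: measurable_compose[OF block_index_measurable])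
  have expand: "F (\<lambda>v\<in>V. block_index n (x v)) = (\<Sum>z\<in>?Z. F z * (\<Prod>v\<in>V. of_bool (block_index n (x v) = z v)))"
    if x: "x \<in> space ?M" for x
  proof -
    let ?z = "\<lambda>v\<in>V. block_index n (x v)"
    have z: "?z \<in> ?Z"
      using x block_index_le by (auto simp: space_PiM space_restrict_space PiE_iff)
    have "(\<Prod>v\<in>V. of_bool (block_index n (x v) = z v)) = (of_bool (z = ?z) :: real)" if "z \<in> ?Z" for z
    proof (cases "\<forall>v\<in>V. block_index n (x v) = z v")
      case True
      then have "z = ?z"
        using that by (auto simp: PiE_iff extensional_def fun_eq_iff)
      then show ?thesis using True by simp
    next
      case False
      then obtain v where "v \<in> V" "block_index n (x v) \<noteq> z v" by blast
      then have "z \<noteq> ?z" by auto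
      then show ?thesis using False \<open>finite V\<close> by auto
    qed
    then have "(\<Sum>z\<in>?Z. F z * (\<Prod>v\<in>V. of_bool (block_index n (x v) = z v))) = (\<Sum>z\<in>?Z. F z * of_bool (z = ?z))"
      by simp
    also have "\<dots> = F ?z"
      using fin z by (simp add: of_bool_def if_distrib sum.delta' cong: if_cong)
    finally show ?thesis by simp
  qed
  have "(LINT x|?M. F (\<lambda>v\<in>V. block_index n (x v)))
      = (LINT x|?M. (\<Sum>z\<in>?Z. F z * (\<Prod>v\<in>V. of_bool (block_index n (x v) = z v))))"
    by (intro Bochner_Integration.integral_cong refl expand)
  also have "\<dots> = (\<Sum>z\<in>?Z. F z * (LINT x|?M. (\<Prod>v\<in>V. of_bool (block_index n (x v) = z v))))"
    using assms int1 by (subst Bochner_Integration.integral_sum) (auto intro!: integrable_mult_right product_integrable_prod)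
  also have "\<dots> = (\<Sum>z\<in>?Z. F z * (\<Prod>v\<in>V. if z v = 0 then 0 else 1 / real n))"
  proof (intro sum.cong refl arg_cong2[where f = times])
    fix z assume z: "z \<in> ?Z"
    have "(LINT x|?M. (\<Prod>v\<in>V. of_bool (block_index n (x v) = z v))) =
        (\<Prod>v\<in>V. LINT y|unit_lborel. of_bool (block_index n y = z v) :: real)"
      using assms int1 by (intro product_integral_prod)
    also have "\<dots> = (\<Prod>v\<in>V. if z v = 0 then 0 else 1 / real n)"
      using assms z by (intro prod.cong refl integral_block_index_eq) (auto simp: PiE_iff)
    finally show "(LINT x|?M. (\<Prod>v\<in>V. of_bool (block_index n (x v) = z v))) =
        (\<Prod>v\<in>V. if z v = 0 then 0 else 1 / real n)" .
  qed
  also have "\<dots> = (\<Sum>z\<in>V \<rightarrow>\<^sub>E {1..n}. F z * (\<Prod>v\<in>V. if z v = 0 then 0 else 1 / real n))"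
  proof (rule sum.mono_neutral_right[OF fin])
    show "V \<rightarrow>\<^sub>E {1..n} \<subseteq> ?Z" by (intro PiE_mono) auto
    show "\<forall>z\<in>?Z - (V \<rightarrow>\<^sub>E {1..n}). F z * (\<Prod>v\<in>V. if z v = 0 then 0 else 1 / real n) = 0"
    proof
      fix z assume "z \<in> ?Z - (V \<rightarrow>\<^sub>E {1..n})"
      then obtain v where "v \<in> V" "z v = 0"
        by (auto simp: PiE_iff Suc_le_eq)
      then have "(\<Prod>v\<in>V. if z v = 0 then 0 else 1 / real n) = 0"
        by (intro prod_zero[OF \<open>finite V\<close>] bexI[of _ v]) auto
      then show "F z * (\<Prod>v\<in>V. if z v = 0 then 0 else 1 / real n) = 0" by simp
    qed
  qed
  also have "\<dots> = (\<Sum>z\<in>V \<rightarrow>\<^sub>E {1..n}. F z * (1 / real n) ^ card V)"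
  proof (intro sum.cong refl arg_cong2[where f = times])
    fix z assume "z \<in> V \<rightarrow>\<^sub>E {1..n}"
    then have "z v \<noteq> 0" if "v \<in> V" for v using that by (force simp: PiE_iff)
    then have "(\<Prod>v\<in>V. if z v = 0 then 0 else 1 / real n) = (\<Prod>v\<in>V. 1 / real n)"
      by (intro prod.cong refl if_not_P) fast
    then show "(\<Prod>v\<in>V. if z v = 0 then 0 else 1 / real n) = (1 / real n) ^ card V" by simp
  qed
  also have "\<dots> = (\<Sum>z\<in>V \<rightarrow>\<^sub>E {1..n}. F z) / real n ^ card V"
    by (simp add: sum_divide_distrib power_one_over)
  finally show ?thesis .
qed

lemma step_graphon_measurable:
  assumes "\<And>i j. w i j \<in> space N"
  shows "step_graphon n w \<in> measurable unit_square N"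
proof -
  have idx: "(\<lambda>p. block_index n (fst p)) \<in> measurable unit_square (count_space UNIV)"
    "(\<lambda>p. block_index n (snd p)) \<in> measurable unit_square (count_space UNIV)"
    by measurable
  have "(\<lambda>p. w i (block_index n (snd p))) \<in> measurable unit_square N" for i
    using assms by (intro measurable_compose[OF idx(2)]) simp
  then have "(\<lambda>p. w (block_index n (fst p)) (block_index n (snd p))) \<in> measurable unit_square N"
    by (rule measurable_compose_countable[OF _ idx(1)])
  then show ?thesis by (simp add: step_graphon_def case_prod_beta)
qed

lemma integral_block_index:
  assumes "n > 0"
  shows "(LINT x|unit_lborel. f (block_index n x)) = (\<Sum>i=1..n. f i) / real n"
proof -
  have int: "integrable unit_lborel (\<lambda>y. f i * of_bool (block_index n y = i) :: real)" for i
    by (intro integrable_mult_right unit.integrable_bounded[of _ 1])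
       (auto intro!: measurable_compose[OF block_index_measurable])
  have "(LINT x|unit_lborel. f (block_index n x)) =
      (LINT x|unit_lborel. (\<Sum>i\<in>{0..n}. f i * of_bool (block_index n x = i)))"
  proof (intro Bochner_Integration.integral_cong refl)
    fix x :: real assume "x \<in> space unit_lborel"
    then have "block_index n x \<in> {0..n}" using block_index_le by (simp add: space_restrict_space)
    then show "f (block_index n x) = (\<Sum>i\<in>{0..n}. f i * of_bool (block_index n x = i))"
      by (simp add: of_bool_def if_distrib sum.delta cong: if_cong)
  qed
  also have "\<dots> = (\<Sum>i\<in>{0..n}. f i * (LINT x|unit_lborel. of_bool (block_index n x = i)))"
    using int by (subst Bochner_Integration.integral_sum) (intro int, simp only: integral_mult_right_zero)
  also have "\<dots> = (\<Sum>i\<in>{0..n}. f i * (if i = 0 then 0 else 1 / real n))"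
    using assms by (intro sum.cong refl) (simp add: integral_block_index_eq)
  also have "\<dots> = (\<Sum>i=1..n. f i) / real n"
    by (simp add: sum.atLeast_Suc_atMost sum_divide_distrib)
  finally show ?thesis .
qed

lemma integral_step_graphon:
  fixes f :: "nat \<Rightarrow> nat \<Rightarrow> real"
  assumes "n > 0"
  shows "(LINT p|unit_square. step_graphon n f p) = (\<Sum>i=1..n. \<Sum>j=1..n. f i j) / (real n)\<^sup>2"
proof -
  have "integrable unit_square (step_graphon n f)"
  proof (rule unit2.integrable_bounded[OF step_graphon_measurable])
    fix p assume "p \<in> space unit_square"
    then obtain x y where p: "p = (x, y)" "x \<in> {0..1}" "y \<in> {0..1}"
      by (auto simp: space_unit_square)
    then have "\<bar>step_graphon n f p\<bar> \<le> (\<Sum>j\<in>{0..n}. \<bar>f (block_index n x) j\<bar>)"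
      unfolding step_graphon_def using block_index_le
      by (auto intro!: member_le_sum[of "block_index n y" "{0..n}" "\<lambda>j. \<bar>f (block_index n x) j\<bar>"])
    also have "\<dots> \<le> (\<Sum>i\<in>{0..n}. \<Sum>j\<in>{0..n}. \<bar>f i j\<bar>)"
      using p block_index_le
      by (intro member_le_sum[of "block_index n x" "{0..n}" "\<lambda>i. \<Sum>j\<in>{0..n}. \<bar>f i j\<bar>"] sum_nonneg) auto
    finally show "\<bar>step_graphon n f p\<bar> \<le> (\<Sum>i\<in>{0..n}. \<Sum>j\<in>{0..n}. \<bar>f i j\<bar>)" .
  qed simp
  then have "(LINT p|unit_square. step_graphon n f p) =
      (LINT x|unit_lborel. LINT y|unit_lborel. step_graphon n f (x, y))"
    by (simp add: unit2.integral_fst')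
  also have "\<dots> = (\<Sum>i=1..n. \<Sum>j=1..n. f i j) / (real n)\<^sup>2"
    unfolding step_graphon_def prod.case integral_block_index[OF assms]
      integral_block_index[OF assms, of "\<lambda>i. (\<Sum>j=1..n. f i j) / real n"]
    by (simp add: sum_divide_distrib[symmetric] power2_eq_square)
  finally show ?thesis .
qed

text \<open>The homomorphism density of a weighted graph on {1..n}; non-injective maps are included,
  so diagonal entries of \<open>u\<close> do enter.\<close>

definition discrete_density :: "'v::linorder set \<Rightarrow> 'v set set \<Rightarrow> nat \<Rightarrow> (nat \<Rightarrow> nat \<Rightarrow> real) \<Rightarrow> real" where
  "discrete_density V E n u =
    (\<Sum>z\<in>V \<rightarrow>\<^sub>E {1..n}. \<Prod>e\<in>E. u (z (Min e)) (z (Max e))) / real n ^ card V"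

lemma hom_density_step_graphon:
  assumes "simple_graph V E" "n > 0"
  shows "hom_density V E (step_graphon n u) = discrete_density V E n u"
proof -
  have "hom_density V E (step_graphon n u) = (LINT x|Pi\<^sub>M V (\<lambda>_. unit_lborel).
      (\<lambda>z. \<Prod>e\<in>E. u (z (Min e)) (z (Max e))) (\<lambda>v\<in>V. block_index n (x v)))"
    unfolding hom_density_def step_graphon_def
    using simple_graphD(3,4)[OF assms(1)] by (intro Bochner_Integration.integral_cong refl prod.cong) auto
  also have "\<dots> = discrete_density V E n u"
    unfolding discrete_density_def
    by (intro integral_cube_block_index simple_graphD(1)[OF assms(1)] assms(2))
  finally show ?thesis .
qed

text \<open>Removes measure theory from the estimates at fixed \<open>n\<close>: the Hamiltonian
  becomes a polynomial in the matrix entries.\<close>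

lemma graphon_hamiltonian_step:
  fixes w :: "nat \<Rightarrow> nat \<Rightarrow> real ^ 'k::finite" and V :: "nat \<Rightarrow> 'v::linorder set"
  assumes "\<And>s. s \<in> {1..R} \<Longrightarrow> simple_graph (V s) (E s)" "n > 0"
  shows "graphon_hamiltonian c R \<gamma> \<alpha> V E (step_graphon n w) =
    (\<Sum>i=1..n. \<Sum>j=1..n. c \<bullet> w i j) / (real n)\<^sup>2 +
    (\<Sum>s=1..R. \<gamma> s * discrete_density (V s) (E s) n (\<lambda>i j. \<alpha> s \<bullet> w i j))"
proof -
  have *: "(\<lambda>p. a \<bullet> step_graphon n w p) = step_graphon n (\<lambda>i j. a \<bullet> w i j)" for a
    by (auto simp: step_graphon_def)
  have "edge_density (step_graphon n (\<lambda>i j. c \<bullet> w i j)) = (\<Sum>i=1..n. \<Sum>j=1..n. c \<bullet> w i j) / (real n)\<^sup>2"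
    using integral_step_graphon[OF assms(2)] by (subst edge_density_eq) (auto intro: step_graphon_measurable)
  then show ?thesis
    unfolding graphon_hamiltonian_def * using assms by (simp add: hom_density_step_graphon)
qed

lemma graphon_entropy_step:
  assumes "n > 0"
  shows "graphon_entropy (step_graphon n w) = (\<Sum>i=1..n. \<Sum>j=1..n. entropy_fun (w i j)) / (real n)\<^sup>2"
proof -
  have "(\<lambda>p. entropy_fun (step_graphon n w p)) = step_graphon n (\<lambda>i j. entropy_fun (w i j))"
    by (auto simp: step_graphon_def)
  then show ?thesis
    unfolding graphon_entropy_def using integral_step_graphon[OF assms] by simp
qed

lemma step_graphon_in_graphons:
  fixes w :: "nat \<Rightarrow> nat \<Rightarrow> real ^ 'k::finite"
  assumes "\<And>i j. w i j = w j i" "\<And>i j. w i j \<in> prob_simplex"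
  shows "step_graphon n w \<in> graphons"
  unfolding graphons_def using assms step_graphon_measurable[of w borel n]
  by (auto simp: step_graphon_def)

text \<open>The uniform default also covers the index 0 and indices beyond \<open>n\<close>, so
  every entry lies in the simplex without side conditions.\<close>

definition empirical_matrix :: "nat \<Rightarrow> (nat set \<Rightarrow> 'k::finite) \<Rightarrow> nat \<Rightarrow> nat \<Rightarrow> real ^ 'k" where
  "empirical_matrix n X u v = (if {u, v} \<in> [{1..n}]\<^bsup>2\<^esup> then (\<chi> a. if X {u, v} = a then 1 else 0)
     else (\<chi> a. 1 / real CARD('k)))"

lemma empirical_graphon_eq_step: "empirical_graphon n X = step_graphon n (empirical_matrix n X)"
  by (auto simp: empirical_graphon_def step_graphon_def empirical_matrix_def block_index_def Let_def)

lemma empirical_matrix_sym: "empirical_matrix n X u v = empirical_matrix n X v u"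
  by (simp add: empirical_matrix_def insert_commute)

lemma empirical_matrix_in_prob_simplex: "empirical_matrix n X u v \<in> prob_simplex"
  using uniform_in_prob_simplex vertex_in_prob_simplex by (auto simp: empirical_matrix_def)

lemma inner_empirical_matrix:
  assumes "{u, v} \<in> [{1..n}]\<^bsup>2\<^esup>"
  shows "c \<bullet> empirical_matrix n X u v = c $ X {u, v}"
  using assms by (simp add: empirical_matrix_def inner_vec_def if_distrib sum.delta' cong: if_cong)

section \<open>Random colourings and entropy\<close>

lemma finite_nsets_two: "finite ([{1..n::nat}]\<^bsup>2\<^esup>)"
  by (simp add: finite_imp_finite_nsets)

lemma finite_colorings: "finite (colorings n :: (nat set \<Rightarrow> 'k::finite) set)"
  unfolding colorings_def using finite_nsets_two by (intro finite_PiE) auto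

lemma colorings_nonempty: "colorings n \<noteq> {}"
  unfolding colorings_def by (simp add: PiE_eq_empty_iff)

text \<open>Independence of the colours of different edges: edges outside \<open>J\<close> get the
  factor 1, and the sum over all colourings factors into one sum per edge.\<close>

lemma sum_prod_PiE_expectation:
  fixes \<mu> :: "'k::finite \<Rightarrow> real"
  assumes "finite K" "J \<subseteq> K" "sum \<mu> UNIV = 1"
  shows "(\<Sum>X\<in>K \<rightarrow>\<^sub>E UNIV. (\<Prod>e\<in>K. \<mu> (X e)) * (\<Prod>e\<in>J. f e (X e))) = (\<Prod>e\<in>J. \<Sum>a\<in>UNIV. \<mu> a * f e a)"
proof -
  have "(\<Prod>e\<in>K. \<mu> (X e)) * (\<Prod>e\<in>J. f e (X e)) = (\<Prod>e\<in>K. \<mu> (X e) * (if e \<in> J then f e (X e) else 1))" for X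
  proof -
    have "(\<Prod>e\<in>J. f e (X e)) = (\<Prod>e\<in>K. if e \<in> J then f e (X e) else 1)"
      using assms(1,2) by (simp add: prod.If_cases Int_absorb1)
    then show ?thesis by (simp add: prod.distrib)
  qed
  then have "(\<Sum>X\<in>K \<rightarrow>\<^sub>E UNIV. (\<Prod>e\<in>K. \<mu> (X e)) * (\<Prod>e\<in>J. f e (X e))) =
      (\<Sum>X\<in>K \<rightarrow>\<^sub>E UNIV. \<Prod>e\<in>K. \<mu> (X e) * (if e \<in> J then f e (X e) else 1))"
    by simp
  also have "\<dots> = (\<Prod>e\<in>K. \<Sum>a\<in>UNIV. \<mu> a * (if e \<in> J then f e a else 1))"
    using prod_sum_PiE[of K "\<lambda>_. UNIV" "\<lambda>e a. \<mu> a * (if e \<in> J then f e a else 1)"] assms(1) by simp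
  also have "\<dots> = (\<Prod>e\<in>K. if e \<in> J then (\<Sum>a\<in>UNIV. \<mu> a * f e a) else 1)"
    using assms(3) by (intro prod.cong) auto
  also have "\<dots> = (\<Prod>e\<in>J. \<Sum>a\<in>UNIV. \<mu> a * f e a)"
    using assms(1,2) by (simp add: prod.If_cases Int_absorb1)
  finally show ?thesis .
qed

section \<open>Bounding the number of colourings in a set by the entropy of their mean\<close>

lemma card_mult_sum_by_value:
  fixes f :: "'k::finite \<Rightarrow> real"
  assumes "finite A"
  shows "(\<Sum>X\<in>A. f (X e)) = (\<Sum>a\<in>UNIV. real (card {X \<in> A. X e = a}) * f a)"
proof -
  have "(\<Sum>X\<in>A. f (X e)) = (\<Sum>a\<in>UNIV. \<Sum>X\<in>{X \<in> A. X e = a}. f (X e))"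
    using sum.group[of A UNIV "\<lambda>X. X e" "\<lambda>X. f (X e)"] assms by simp
  also have "\<dots> = (\<Sum>a\<in>UNIV. real (card {X \<in> A. X e = a}) * f a)"
    by (intro sum.cong refl) simp
  finally show ?thesis .
qed

text \<open>Subadditivity of the entropy, applied to the uniform distribution on \<open>A\<close>.\<close>

lemma ln_card_le_sum_marginal_entropy:
  fixes A :: "('e \<Rightarrow> 'k::finite) set"
  assumes "finite K" "A \<subseteq> K \<rightarrow>\<^sub>E UNIV" "A \<noteq> {}"
  defines "p \<equiv> \<lambda>e a. real (card {X \<in> A. X e = a}) / real (card A)"
  shows "ln (card A) \<le> - (\<Sum>e\<in>K. \<Sum>a\<in>UNIV. p e a * ln (p e a))"
proof -
  have "finite (K \<rightarrow>\<^sub>E (UNIV :: 'k set))"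
    using assms(1) by (simp add: finite_PiE)
  then have fin: "finite A" using assms(2) finite_subset by blast
  then have A: "real (card A) > 0" using assms(3) by (simp add: card_gt_0_iff)
  have p0: "0 \<le> p e a" for e a by (simp add: p_def)
  have p_sum: "(\<Sum>a\<in>UNIV. p e a) = 1" for e
    using card_mult_sum_by_value[OF fin, of "\<lambda>_. 1" e] A by (simp add: p_def sum_divide_distrib[symmetric])
  have ppos: "0 < p e (X e)" if "X \<in> A" for X e
    unfolding p_def using A fin that by (intro divide_pos_pos) (auto simp: card_gt_0_iff)
  \<comment> \<open>The product of the marginals is a probability on all of
    \<open>K \<rightarrow>\<^sub>E UNIV\<close>, so its mass on \<open>A\<close> is at most 1, the
    mass of the uniform law on \<open>A\<close>; it is positive there by
    \<open>ppos\<close>.\<close>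
  define r where "r X = (\<Prod>e\<in>K. p e (X e))" for X
  have "sum r A \<le> sum r (K \<rightarrow>\<^sub>E UNIV)"
    using assms(1,2) p0 by (intro sum_mono2 finite_PiE) (auto simp: r_def intro!: prod_nonneg)
  also have "\<dots> = 1"
    using prod_sum_PiE[of K "\<lambda>_. UNIV" p] assms(1) by (simp add: r_def p_sum)
  also have "1 = (\<Sum>X\<in>A. 1 / real (card A))" using A by simp
  finally have "(\<Sum>X\<in>A. 1 / real (card A) * ln (r X)) \<le> (\<Sum>X\<in>A. 1 / real (card A) * ln (1 / real (card A)))"
    by (intro gibbs_inequality) (auto simp: r_def intro!: prod_pos ppos)
  also have "\<dots> = - ln (card A)"
    using A by (simp add: ln_div)
  also have "(\<Sum>X\<in>A. 1 / real (card A) * ln (r X)) = (\<Sum>X\<in>A. \<Sum>e\<in>K. ln (p e (X e)) / real (card A))"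
  proof (intro sum.cong refl)
    fix X assume "X \<in> A"
    have "p e (X e) \<noteq> 0" for e using ppos[OF \<open>X \<in> A\<close>, of e] by simp
    then have "ln (r X) = (\<Sum>e\<in>K. ln (p e (X e)))"
      unfolding r_def using assms(1) by (intro ln_prod) auto
    then show "1 / real (card A) * ln (r X) = (\<Sum>e\<in>K. ln (p e (X e)) / real (card A))"
      by (simp add: sum_divide_distrib)
  qed
  also have "\<dots> = (\<Sum>e\<in>K. \<Sum>X\<in>A. ln (p e (X e)) / real (card A))"
    by (rule sum.swap)
  also have "\<dots> = (\<Sum>e\<in>K. \<Sum>a\<in>UNIV. p e a * ln (p e a))"
    using card_mult_sum_by_value[OF fin, of "\<lambda>a. ln (p _ a) / real (card A)"]
    by (intro sum.cong refl) (simp add: p_def)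
  finally show ?thesis by simp
qed

text \<open>Each edge appears once above and once below the diagonal. This is the origin of the
  factor 1/2 in the entropy term.\<close>

lemma sum_square_eq_sum_nsets:
  fixes g :: "nat \<Rightarrow> nat \<Rightarrow> real"
  assumes "\<And>u v. u \<in> {1..n} \<Longrightarrow> v \<in> {1..n} \<Longrightarrow> u \<noteq> v \<Longrightarrow> g u v = h {u, v}"
  shows "(\<Sum>u=1..n. \<Sum>v=1..n. g u v) = 2 * (\<Sum>e\<in>[{1..n}]\<^bsup>2\<^esup>. h e) + (\<Sum>u=1..n. g u u)"
proof -
  let ?L = "{p \<in> {1..n} \<times> {1..n}. fst p < snd p}" and ?G = "{p \<in> {1..n} \<times> {1..n}. snd p < fst p}"
    and ?D = "{p \<in> {1..n} \<times> {1..n}. fst p = snd p}"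
  let ?g = "\<lambda>p. g (fst p) (snd p)"
  have L: "sum ?g ?L = (\<Sum>e\<in>[{1..n}]\<^bsup>2\<^esup>. h e)"
  proof -
    have bij: "bij_betw (\<lambda>p. {fst p, snd p}) ?L ([{1..n}]\<^bsup>2\<^esup>)"
    proof (rule bij_betw_imageI)
      show "inj_on (\<lambda>p. {fst p, snd p}) ?L"
        by (rule inj_onI) (auto simp: doubleton_eq_iff)
      show "(\<lambda>p. {fst p, snd p}) ` ?L = [{1..n}]\<^bsup>2\<^esup>"
      proof
        show "[{1..n}]\<^bsup>2\<^esup> \<subseteq> (\<lambda>p. {fst p, snd p}) ` ?L"
          unfolding ordered_nsets_2_eq
        proof clarify
          fix x y assume "x \<in> {1..n}" "y \<in> {1..n}" "x < y"
          then show "{x, y} \<in> (\<lambda>p. {fst p, snd p}) ` ?L"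
            by (intro image_eqI[of _ _ "(x, y)"]) auto
        qed
      qed auto
    qed
    show ?thesis
      unfolding sum.reindex_bij_betw[OF bij, symmetric] using assms by (intro sum.cong) auto
  qed
  have "sum ?g ?G = sum ?g ?L"
    by (rule sum.reindex_bij_witness[of _ prod.swap prod.swap]) (use assms in \<open>auto simp: insert_commute\<close>)
  moreover have "sum ?g ?D = (\<Sum>u=1..n. g u u)"
    by (rule sum.reindex_bij_witness[of _ "\<lambda>u. (u, u)" fst]) auto
  moreover have "(\<Sum>u=1..n. \<Sum>v=1..n. g u v) = sum ?g ({1..n} \<times> {1..n})"
    by (simp add: sum.cartesian_product case_prod_beta)
  moreover have "{1..n} \<times> {1..n} = ?L \<union> ?G \<union> ?D" by auto
  moreover have "sum ?g (?L \<union> ?G \<union> ?D) = sum ?g ?L + sum ?g ?G + sum ?g ?D"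
    by (subst sum.union_disjoint, (auto)[3], subst sum.union_disjoint, auto)
  ultimately show ?thesis using L by simp
qed

text \<open>Off the diagonal the entries are the marginal colour laws under the uniform distribution
  on \<open>A\<close> (see \<open>mean_matrix_nth\<close>); on the diagonal they stay
  uniform.\<close>

definition mean_matrix :: "nat \<Rightarrow> (nat set \<Rightarrow> 'k::finite) set \<Rightarrow> nat \<Rightarrow> nat \<Rightarrow> real ^ 'k" where
  "mean_matrix n A u v = (1 / real (card A)) *\<^sub>R (\<Sum>X\<in>A. empirical_matrix n X u v)"

lemma mean_matrix_sym: "mean_matrix n A u v = mean_matrix n A v u"
  by (simp add: mean_matrix_def empirical_matrix_sym)

lemma mean_matrix_in_prob_simplex:
  assumes "finite A" "A \<noteq> {}"
  shows "mean_matrix n A u v \<in> prob_simplex"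
proof (rule prob_simplexI)
  show "0 \<le> mean_matrix n A u v $ a" for a
    using prob_simplexD(1)[OF empirical_matrix_in_prob_simplex] by (auto simp: mean_matrix_def intro!: divide_nonneg_nonneg sum_nonneg)
  have "(\<Sum>a\<in>UNIV. mean_matrix n A u v $ a) = 1 / real (card A) * (\<Sum>X\<in>A. \<Sum>a\<in>UNIV. empirical_matrix n X u v $ a)"
    unfolding mean_matrix_def by (subst sum.swap) (simp add: sum_divide_distrib[symmetric])
  also have "\<dots> = 1"
    unfolding prob_simplexD(3)[OF empirical_matrix_in_prob_simplex] using assms by simp
  finally show "(\<Sum>a\<in>UNIV. mean_matrix n A u v $ a) = 1" .
qed

lemma mean_matrix_nth:
  assumes "{u, v} \<in> [{1..n}]\<^bsup>2\<^esup>" "finite A"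
  shows "mean_matrix n A u v $ a = real (card {X \<in> A. X {u, v} = a}) / real (card A)"
proof -
  have "(\<Sum>X\<in>A. empirical_matrix n X u v $ a) = (\<Sum>X\<in>A. of_bool (X {u, v} = a))"
    using assms(1) by (intro sum.cong refl) (simp add: empirical_matrix_def)
  also have "\<dots> = real (card {X \<in> A. X {u, v} = a})"
    using assms(2) by (simp add: of_bool_def sum.If_cases Int_def)
  finally show ?thesis by (simp add: mean_matrix_def)
qed

text \<open>Subadditivity gives the sum over edges. The integral over the square also contains the
  diagonal blocks, whose entropy term is nonpositive, so including them only weakens the
  bound.\<close>

lemma ln_card_colorings_le:
  fixes A :: "(nat set \<Rightarrow> 'k::finite) set"
  assumes "A \<subseteq> colorings n" "A \<noteq> {}" "n > 0"
  shows "ln (card A) \<le> - (real n)\<^sup>2 * (1 / 2 * graphon_entropy (step_graphon n (mean_matrix n A)))"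
proof -
  have fin: "finite A" using assms(1) finite_colorings finite_subset by blast
  define p where "p = (\<lambda>e a. real (card {X \<in> A. X e = a}) / real (card A))"
  define h where "h e = (\<Sum>a\<in>UNIV. p e a * ln (p e a))" for e
  let ?w = "mean_matrix n A"
  have ent: "entropy_fun (?w u v) = h {u, v}" if "u \<in> {1..n}" "v \<in> {1..n}" "u \<noteq> v" for u v
    using that fin by (simp add: entropy_fun_def h_def p_def mean_matrix_nth)
  have "(\<Sum>u=1..n. \<Sum>v=1..n. entropy_fun (?w u v)) = 2 * (\<Sum>e\<in>[{1..n}]\<^bsup>2\<^esup>. h e) + (\<Sum>u=1..n. entropy_fun (?w u u))"
    by (intro sum_square_eq_sum_nsets ent)
  moreover have "(\<Sum>u=1..n. entropy_fun (?w u u)) \<le> 0"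
    by (intro sum_nonpos entropy_fun_bounds(2) mean_matrix_in_prob_simplex fin assms)
  moreover have "ln (card A) \<le> - (\<Sum>e\<in>[{1..n}]\<^bsup>2\<^esup>. h e)"
    unfolding h_def p_def using assms finite_nsets_two
    by (intro ln_card_le_sum_marginal_entropy) (auto simp: colorings_def)
  ultimately have "ln (card A) \<le> - (\<Sum>u=1..n. \<Sum>v=1..n. entropy_fun (?w u v)) / 2"
    by simp
  also have "\<dots> = - (real n)\<^sup>2 * (1 / 2 * graphon_entropy (step_graphon n ?w))"
    using assms(3) by (simp add: graphon_entropy_step)
  finally show ?thesis .
qed

section \<open>The lower bound for the free energy, by a product measure\<close>

lemma ln_sum_exp_ge:
  fixes q t :: "'a \<Rightarrow> real"
  assumes "finite A" "A \<noteq> {}" "\<And>X. X \<in> A \<Longrightarrow> 0 \<le> q X" "sum q A = 1"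
  shows "(\<Sum>X\<in>A. q X * t X) - (\<Sum>X\<in>A. q X * ln (q X)) \<le> ln (\<Sum>X\<in>A. exp (t X))"
proof -
  define Z where "Z = (\<Sum>X\<in>A. exp (t X))"
  have Z: "Z > 0" unfolding Z_def using assms by (intro sum_pos) auto
  \<comment> \<open>The Boltzmann weights \<open>exp (t X) / Z\<close> are the reference law in the
    Gibbs inequality.\<close>
  have "sum (\<lambda>X. exp (t X) / Z) A \<le> sum q A"
    using Z assms(4) by (simp add: sum_divide_distrib[symmetric] Z_def)
  then have "(\<Sum>X\<in>A. q X * ln (exp (t X) / Z)) \<le> (\<Sum>X\<in>A. q X * ln (q X))"
    using assms(3) Z by (intro gibbs_inequality) auto
  moreover have "(\<Sum>X\<in>A. q X * ln (exp (t X) / Z)) = (\<Sum>X\<in>A. q X * t X) - ln Z"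
    using Z assms(4) by (simp add: ln_div right_diff_distrib sum_subtractf sum_distrib_right[symmetric])
  ultimately show ?thesis unfolding Z_def by simp
qed

text \<open>Resampling one coordinate: overwriting \<open>z v\<close> by every value of
  \<open>J\<close> meets each map exactly \<open>card J\<close> times.\<close>

lemma sum_PiE_fun_upd:
  fixes F :: "('v \<Rightarrow> 'a) \<Rightarrow> real"
  assumes "finite J" "v \<in> V"
  shows "real (card J) * (\<Sum>z\<in>V \<rightarrow>\<^sub>E J. F z) = (\<Sum>z\<in>V \<rightarrow>\<^sub>E J. \<Sum>i\<in>J. F (z(v := i)))"
proof -
  define V' where "V' = V - {v}"
  have V: "V = insert v V'" "v \<notin> V'" using assms by (auto simp: V'_def)
  have reduce: "(\<Sum>z\<in>V \<rightarrow>\<^sub>E J. F' z) = (\<Sum>i\<in>J. \<Sum>g\<in>V' \<rightarrow>\<^sub>E J. F' (g(v := i)))" for F' :: "('v \<Rightarrow> 'a) \<Rightarrow> real"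
  proof -
    have "(\<Sum>z\<in>V \<rightarrow>\<^sub>E J. F' z) = (\<Sum>p\<in>J \<times> (V' \<rightarrow>\<^sub>E J). F' ((snd p)(v := fst p)))"
      unfolding V(1) PiE_insert_eq using inj_combinator[OF V(2)]
      by (subst sum.reindex) (auto simp: case_prod_beta)
    then show ?thesis by (simp add: sum.cartesian_product case_prod_beta)
  qed
  have "(\<Sum>z\<in>V \<rightarrow>\<^sub>E J. \<Sum>i\<in>J. F (z(v := i))) = (\<Sum>j\<in>J. \<Sum>g\<in>V' \<rightarrow>\<^sub>E J. \<Sum>i\<in>J. F (g(v := i)))"
    by (subst reduce) simp
  also have "\<dots> = real (card J) * (\<Sum>g\<in>V' \<rightarrow>\<^sub>E J. \<Sum>i\<in>J. F (g(v := i)))"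
    by simp
  also have "\<dots> = real (card J) * (\<Sum>z\<in>V \<rightarrow>\<^sub>E J. F z)"
    unfolding reduce[of F] by (subst sum.swap) simp
  finally show ?thesis by simp
qed

text \<open>Union bound over ordered pairs of vertices, each pair colliding for a fraction 1/n of
  the maps. The pairs with u = v contribute nothing but are counted too, whence the full square of
  \<open>card V\<close>.\<close>

lemma card_inj_PiE_ge:
  assumes "finite V" "n > 0"
  shows "(1 - (real (card V))\<^sup>2 / real n) * real n ^ card V \<le> real (card {z \<in> V \<rightarrow>\<^sub>E {1..n}. inj_on z V})"
proof -
  let ?Z = "V \<rightarrow>\<^sub>E {1..n}"
  have fin: "finite ?Z" using assms by (simp add: finite_PiE)
  have cardZ: "real (card ?Z) = real n ^ card V" using assms by (simp add: card_PiE)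
  have pair: "real n * (\<Sum>z\<in>?Z. of_bool (z u = z v)) = real n ^ card V" if "u \<in> V" "v \<in> V" "u \<noteq> v" for u v
  proof -
    have "real n * (\<Sum>z\<in>?Z. of_bool (z u = z v)) = (\<Sum>z\<in>?Z. \<Sum>i\<in>{1..n}. of_bool (i = z v))"
      using sum_PiE_fun_upd[of "{1..n}" u V "\<lambda>z. of_bool (z u = z v)"] that by simp
    also have "\<dots> = (\<Sum>z\<in>?Z. 1)"
    proof (intro sum.cong refl)
      fix z assume "z \<in> ?Z"
      then have "z v \<in> {1..n}" using that by (auto simp: PiE_iff)
      then show "(\<Sum>i\<in>{1..n}. of_bool (i = z v)) = (1 :: real)"
        by (simp add: of_bool_def sum.delta del: of_bool_eq_iff)
    qed
    finally show ?thesis using cardZ by simp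
  qed
  have "1 \<le> of_bool (inj_on z V) + (\<Sum>u\<in>V. \<Sum>v\<in>V. of_bool (u \<noteq> v \<and> z u = z v) :: real)" for z :: "'a \<Rightarrow> nat"
  proof (cases "inj_on z V")
    case False
    then obtain u v where uv: "u \<in> V" "v \<in> V" "u \<noteq> v" "z u = z v" by (auto simp: inj_on_def)
    have "1 = (of_bool (u \<noteq> v \<and> z u = z v) :: real)" using uv by simp
    also have "\<dots> \<le> (\<Sum>v\<in>V. of_bool (u \<noteq> v \<and> z u = z v))"
      using uv assms by (intro member_le_sum) auto
    also have "\<dots> \<le> (\<Sum>u\<in>V. \<Sum>v\<in>V. of_bool (u \<noteq> v \<and> z u = z v))"
      using uv assms by (intro member_le_sum[of u V "\<lambda>u. \<Sum>v\<in>V. of_bool (u \<noteq> v \<and> z u = z v)"] sum_nonneg) auto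
    finally show ?thesis by simp
  qed (auto intro!: sum_nonneg)
  then have "(\<Sum>z\<in>?Z. 1) \<le> (\<Sum>z\<in>?Z. of_bool (inj_on z V) + (\<Sum>u\<in>V. \<Sum>v\<in>V. of_bool (u \<noteq> v \<and> z u = z v) :: real))"
    by (intro sum_mono)
  also have "\<dots> = real (card {z \<in> ?Z. inj_on z V}) + (\<Sum>z\<in>?Z. \<Sum>u\<in>V. \<Sum>v\<in>V. of_bool (u \<noteq> v \<and> z u = z v))"
    using fin by (simp add: sum.distrib of_bool_def sum.If_cases Int_def)
  also have "(\<Sum>z\<in>?Z. \<Sum>u\<in>V. \<Sum>v\<in>V. of_bool (u \<noteq> v \<and> z u = z v) :: real) =
      (\<Sum>u\<in>V. \<Sum>v\<in>V. \<Sum>z\<in>?Z. of_bool (u \<noteq> v \<and> z u = z v))"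
    by (subst sum.swap) (intro sum.cong refl sum.swap)
  also have "\<dots> \<le> (\<Sum>u\<in>V. \<Sum>v\<in>V. real n ^ card V / real n)"
  proof (intro sum_mono)
    fix u v assume "u \<in> V" "v \<in> V"
    then show "(\<Sum>z\<in>?Z. of_bool (u \<noteq> v \<and> z u = z v)) \<le> real n ^ card V / real n"
      using pair[of u v] assms by (cases "u = v") (auto simp: field_simps)
  qed
  finally show ?thesis
    using cardZ assms by (simp add: algebra_simps power2_eq_square)
qed

lemma card_nsets_two: "2 * real (card ([{1..n}]\<^bsup>2\<^esup>)) = (real n)\<^sup>2 - real n"
  using sum_square_eq_sum_nsets[of n "\<lambda>_ _. 1" "\<lambda>_. 1"] by (simp add: power2_eq_square)

context
  fixes \<mu> :: "real ^ 'k::finite" and n :: nat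
  assumes \<mu>: "\<mu> \<in> prob_simplex" and n: "n > 0"
begin

private abbreviation (input) K where "K \<equiv> [{1..n}]\<^bsup>2\<^esup>"

definition product_weight :: "(nat set \<Rightarrow> 'k) \<Rightarrow> real" where
  "product_weight X = (\<Prod>e\<in>[{1..n}]\<^bsup>2\<^esup>. \<mu> $ X e)"

private abbreviation (input) Q where "Q \<equiv> product_weight"

lemma product_weight_nonneg: "0 \<le> product_weight X"
  unfolding product_weight_def using prob_simplexD(1)[OF \<mu>] by (intro prod_nonneg) auto

lemma product_weight_expectation:
  assumes "J \<subseteq> [{1..n}]\<^bsup>2\<^esup>"
  shows "(\<Sum>X\<in>colorings n. product_weight X * (\<Prod>e\<in>J. f e (X e))) = (\<Prod>e\<in>J. \<Sum>a\<in>UNIV. \<mu> $ a * f e a)"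
  unfolding colorings_def product_weight_def
  using sum_prod_PiE_expectation[OF finite_nsets_two assms prob_simplexD(3)[OF \<mu>]] by simp

lemma product_weight_sum: "(\<Sum>X\<in>colorings n. product_weight X) = 1"
  using product_weight_expectation[of "{}"] by simp

lemma product_weight_expectation_edge:
  assumes "e \<in> [{1..n}]\<^bsup>2\<^esup>"
  shows "(\<Sum>X\<in>colorings n. product_weight X * f (X e)) = (\<Sum>a\<in>UNIV. \<mu> $ a * f a)"
  using product_weight_expectation[of "{e}" "\<lambda>_. f"] assms by simp

text \<open>Entropy is additive over independent edges. Colourings of weight 0, which occur when
  \<open>\<mu>\<close> has zero entries, drop out through the factor in front of the
  logarithm.\<close>

lemma product_weight_entropy:
  "(\<Sum>X\<in>colorings n. product_weight X * ln (product_weight X)) = real (card ([{1..n}]\<^bsup>2\<^esup>)) * entropy_fun \<mu>"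
proof -
  have "Q X * ln (Q X) = (\<Sum>e\<in>K. Q X * ln (\<mu> $ X e))" for X
  proof (cases "Q X = 0")
    case False
    then have "\<forall>e\<in>K. \<mu> $ X e \<noteq> 0"
      unfolding product_weight_def using finite_nsets_two[of n] by (simp add: prod_zero_iff)
    then have "ln (Q X) = (\<Sum>e\<in>K. ln (\<mu> $ X e))"
      unfolding product_weight_def using finite_nsets_two[of n] by (intro ln_prod) auto
    then show ?thesis by (simp add: sum_distrib_left)
  qed simp
  then have "(\<Sum>X\<in>colorings n. Q X * ln (Q X)) = (\<Sum>X\<in>colorings n. \<Sum>e\<in>K. Q X * ln (\<mu> $ X e))"
    by simp
  also have "\<dots> = (\<Sum>e\<in>K. \<Sum>X\<in>colorings n. Q X * ln (\<mu> $ X e))"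
    by (rule sum.swap)
  also have "\<dots> = (\<Sum>e\<in>K. entropy_fun \<mu>)"
    unfolding entropy_fun_def by (intro sum.cong refl product_weight_expectation_edge)
  finally show ?thesis by simp
qed

lemma product_weight_inner:
  "(\<Sum>X\<in>colorings n. product_weight X * (\<Sum>i=1..n. \<Sum>j=1..n. c \<bullet> empirical_matrix n X i j))
    = ((real n)\<^sup>2 - real n) * (c \<bullet> \<mu>) + real n * (c \<bullet> (\<chi> a. 1 / real CARD('k)))"
proof -
  let ?g = "\<lambda>i j. \<Sum>X\<in>colorings n. Q X * (c \<bullet> empirical_matrix n X i j)"
  have "?g i j = c \<bullet> \<mu>" if "i \<in> {1..n}" "j \<in> {1..n}" "i \<noteq> j" for i j
  proof -
    have e: "{i, j} \<in> K" using that by simp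
    have "?g i j = (\<Sum>X\<in>colorings n. Q X * c $ X {i, j})"
      by (simp add: inner_empirical_matrix[OF e])
    also have "\<dots> = c \<bullet> \<mu>"
      unfolding product_weight_expectation_edge[OF e, of "\<lambda>a. c $ a"]
      by (simp add: inner_vec_def mult.commute)
    finally show ?thesis .
  qed
  then have "(\<Sum>i=1..n. \<Sum>j=1..n. ?g i j) = 2 * (\<Sum>e\<in>K. c \<bullet> \<mu>) + (\<Sum>i=1..n. ?g i i)"
    by (intro sum_square_eq_sum_nsets)
  also have "(\<Sum>i=1..n. ?g i i) = real n * (c \<bullet> (\<chi> a. 1 / real CARD('k)))"
  proof -
    have "?g i i = c \<bullet> (\<chi> a. 1 / real CARD('k))" for i
      using product_weight_sum by (simp add: empirical_matrix_def nsets_def sum_distrib_right[symmetric])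
    then show ?thesis by simp
  qed
  also have "2 * (\<Sum>e\<in>K. c \<bullet> \<mu>) = (2 * real (card K)) * (c \<bullet> \<mu>)" by simp
  also have "(\<Sum>i=1..n. \<Sum>j=1..n. ?g i j) = (\<Sum>X\<in>colorings n. Q X * (\<Sum>i=1..n. \<Sum>j=1..n. c \<bullet> empirical_matrix n X i j))"
  proof -
    have "(\<Sum>i=1..n. \<Sum>j=1..n. ?g i j) = (\<Sum>i=1..n. \<Sum>X\<in>colorings n. \<Sum>j=1..n. Q X * (c \<bullet> empirical_matrix n X i j))"
      by (intro sum.cong refl sum.swap)
    also have "\<dots> = (\<Sum>X\<in>colorings n. \<Sum>i=1..n. \<Sum>j=1..n. Q X * (c \<bullet> empirical_matrix n X i j))"
      by (rule sum.swap)
    finally show ?thesis by (simp add: sum_distrib_left)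
  qed
  finally show ?thesis by (simp only: card_nsets_two)
qed

text \<open>An injective vertex map sends distinct edges of the graph to distinct edges of the
  complete graph, so the factors are independent and the expectation is exactly a power. The
  remaining maps contribute nonnegative terms and are dropped.\<close>

lemma product_weight_density:
  fixes V :: "'v::linorder set"
  assumes G: "simple_graph V E" and \<alpha>: "\<And>a. 0 \<le> \<alpha> $ a"
  shows "(1 - (real (card V))\<^sup>2 / real n) * (\<alpha> \<bullet> \<mu>) ^ card E
    \<le> (\<Sum>X\<in>colorings n. product_weight X * discrete_density V E n (\<lambda>i j. \<alpha> \<bullet> empirical_matrix n X i j))"
proof -
  let ?Z = "V \<rightarrow>\<^sub>E {1..n}"
  let ?P = "\<lambda>X z. \<Prod>e\<in>E. \<alpha> \<bullet> empirical_matrix n X (z (Min e)) (z (Max e))"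
  note V = simple_graphD(1)[OF G]
  have finZ: "finite ?Z" using V by (simp add: finite_PiE)
  have term_nonneg: "0 \<le> (\<Sum>X\<in>colorings n. Q X * ?P X z)" for z
    by (intro sum_nonneg mult_nonneg_nonneg product_weight_nonneg prod_nonneg ballI
        inner_prob_simplex_nonneg empirical_matrix_in_prob_simplex \<alpha>)
  have inj_term: "(\<Sum>X\<in>colorings n. Q X * ?P X z) = (\<alpha> \<bullet> \<mu>) ^ card E" if z: "z \<in> ?Z" "inj_on z V" for z
  proof -
    have eV: "e \<subseteq> V" if "e \<in> E" for e
      using G that by (auto simp: simple_graph_def nsets_def)
    have inj: "inj_on ((`) z) E"
      using inj_on_image_Pow[OF z(2)] eV by (meson PowI inj_on_subset subsetI)
    have img: "{z (Min e), z (Max e)} = z ` e" if "e \<in> E" for e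
      using simple_graphD(6)[OF G that] by (metis image_empty image_insert)
    have zK: "{z (Min e), z (Max e)} \<in> K" if "e \<in> E" for e
      using simple_graphD(3-5)[OF G that] z by (auto simp: PiE_iff inj_on_def)
    have "?P X z = (\<Prod>e\<in>(`) z ` E. \<alpha> $ X e)" for X
    proof -
      have "?P X z = (\<Prod>e\<in>E. \<alpha> $ X (z ` e))"
        using zK img by (intro prod.cong refl) (simp add: inner_empirical_matrix)
      then show ?thesis using inj by (simp add: prod.reindex)
    qed
    then have "(\<Sum>X\<in>colorings n. Q X * ?P X z) = (\<Sum>X\<in>colorings n. Q X * (\<Prod>e\<in>(`) z ` E. \<alpha> $ X e))"
      by simp
    also have "\<dots> = (\<Prod>e\<in>(`) z ` E. \<Sum>a\<in>UNIV. \<mu> $ a * \<alpha> $ a)"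
      using zK img by (intro product_weight_expectation) auto
    also have "\<dots> = (\<alpha> \<bullet> \<mu>) ^ card E"
      using inj by (simp add: card_image inner_vec_def mult.commute)
    finally show ?thesis .
  qed
  have "(1 - (real (card V))\<^sup>2 / real n) * real n ^ card V * (\<alpha> \<bullet> \<mu>) ^ card E
      \<le> real (card {z \<in> ?Z. inj_on z V}) * (\<alpha> \<bullet> \<mu>) ^ card E"
    by (intro mult_right_mono card_inj_PiE_ge V n zero_le_power inner_prob_simplex_nonneg \<mu> \<alpha>)
  also have "\<dots> = (\<Sum>z\<in>{z \<in> ?Z. inj_on z V}. \<Sum>X\<in>colorings n. Q X * ?P X z)"
    by (simp add: inj_term)
  also have "\<dots> \<le> (\<Sum>z\<in>?Z. \<Sum>X\<in>colorings n. Q X * ?P X z)"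
    using finZ term_nonneg by (intro sum_mono2) auto
  also have "\<dots> = (\<Sum>X\<in>colorings n. Q X * (\<Sum>z\<in>?Z. ?P X z))"
    by (subst sum.swap) (simp add: sum_distrib_left)
  finally have "(1 - (real (card V))\<^sup>2 / real n) * real n ^ card V * (\<alpha> \<bullet> \<mu>) ^ card E / real n ^ card V
      \<le> (\<Sum>X\<in>colorings n. Q X * (\<Sum>z\<in>?Z. ?P X z)) / real n ^ card V"
    by (rule divide_right_mono) simp
  then show ?thesis
    using n by (simp add: discrete_density_def sum_divide_distrib[of _ "colorings n"])
qed

end

lemma free_energy_ge:
  fixes c :: "real ^ 'k::finite" and V :: "nat \<Rightarrow> 'v::linorder set"
  assumes G: "\<And>s. s \<in> {1..R} \<Longrightarrow> simple_graph (V s) (E s)"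
    and \<alpha>: "\<And>s a. s \<in> {1..R} \<Longrightarrow> \<alpha> s $ a \<ge> 0"
    and \<gamma>: "\<And>s. s \<in> {1..R} \<Longrightarrow> \<gamma> s \<ge> 0"
    and \<mu>: "\<mu> \<in> prob_simplex"
  shows "\<exists>D. \<forall>n>0. scalar_functional c R \<gamma> \<alpha> E \<mu> - D / real n
    \<le> free_energy (graphon_hamiltonian c R \<gamma> \<alpha> V E) n"
proof -
  let ?B = "c \<bullet> (\<chi> a. 1 / real CARD('k))"
  let ?P = "\<lambda>s. (\<alpha> s \<bullet> \<mu>) ^ card (E s)"
  \<comment> \<open>Three corrections of order 1/n: the diagonal blocks in the linear term, the
    non-injective vertex maps, and the n missing diagonal pairs in the entropy.\<close>
  define D where "D = c \<bullet> \<mu> - ?B + (\<Sum>s=1..R. \<gamma> s * (real (card (V s)))\<^sup>2 * ?P s) - entropy_fun \<mu> / 2"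
  have "scalar_functional c R \<gamma> \<alpha> E \<mu> - D / real n \<le> free_energy (graphon_hamiltonian c R \<gamma> \<alpha> V E) n"
    if n: "n > 0" for n
  proof -
    let ?T = "graphon_hamiltonian c R \<gamma> \<alpha> V E" and ?Q = "product_weight \<mu> n" and ?N = "real n"
    let ?C = "colorings n :: (nat set \<Rightarrow> 'k) set"
    let ?dd = "\<lambda>X s. discrete_density (V s) (E s) n (\<lambda>i j. \<alpha> s \<bullet> empirical_matrix n X i j)"
    let ?lin = "\<lambda>X. \<Sum>i=1..n. \<Sum>j=1..n. c \<bullet> empirical_matrix n X i j"
    have T: "?T (empirical_graphon n X) = ?lin X / ?N\<^sup>2 + (\<Sum>s=1..R. \<gamma> s * ?dd X s)" for X
      unfolding empirical_graphon_eq_step using G n by (intro graphon_hamiltonian_step)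
    have "(\<Sum>X\<in>?C. ?Q X * ?T (empirical_graphon n X)) =
        (\<Sum>X\<in>?C. ?Q X * ?lin X) / ?N\<^sup>2 + (\<Sum>X\<in>?C. \<Sum>s=1..R. \<gamma> s * (?Q X * ?dd X s))"
      unfolding T by (simp add: distrib_left sum.distrib sum_divide_distrib sum_distrib_left mult.left_commute)
    also have "(\<Sum>X\<in>?C. \<Sum>s=1..R. \<gamma> s * (?Q X * ?dd X s)) = (\<Sum>s=1..R. \<gamma> s * (\<Sum>X\<in>?C. ?Q X * ?dd X s))"
      by (subst sum.swap) (simp add: sum_distrib_left)
    finally have ET: "(\<Sum>X\<in>?C. ?Q X * ?T (empirical_graphon n X)) =
        ((?N\<^sup>2 - ?N) * (c \<bullet> \<mu>) + ?N * ?B) / ?N\<^sup>2 + (\<Sum>s=1..R. \<gamma> s * (\<Sum>X\<in>?C. ?Q X * ?dd X s))"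
      using product_weight_inner[OF \<mu> n] by simp
    have dens: "(\<Sum>s=1..R. \<gamma> s * ((1 - (real (card (V s)))\<^sup>2 / ?N) * ?P s)) \<le> (\<Sum>s=1..R. \<gamma> s * (\<Sum>X\<in>?C. ?Q X * ?dd X s))"
      using G \<alpha> \<gamma> by (intro sum_mono mult_left_mono product_weight_density[OF \<mu> n]) auto
    have "(\<Sum>s=1..R. \<gamma> s * ((1 - (real (card (V s)))\<^sup>2 / ?N) * ?P s)) =
        (\<Sum>s=1..R. \<gamma> s * ?P s) - (\<Sum>s=1..R. \<gamma> s * (real (card (V s)))\<^sup>2 * ?P s) / ?N"
      by (simp add: sum_subtractf[symmetric] sum_divide_distrib algebra_simps)
    note ET' = ET dens[unfolded this]
    have "(\<Sum>X\<in>?C. ?Q X * (?N\<^sup>2 * ?T (empirical_graphon n X))) - (\<Sum>X\<in>?C. ?Q X * ln (?Q X))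
        \<le> ln (\<Sum>X\<in>?C. exp (?N\<^sup>2 * ?T (empirical_graphon n X)))"
      using product_weight_sum[OF \<mu> n] product_weight_nonneg[OF \<mu> n]
      by (intro ln_sum_exp_ge finite_colorings colorings_nonempty) auto
    moreover have "(\<Sum>X\<in>?C. ?Q X * (?N\<^sup>2 * ?T (empirical_graphon n X))) = ?N\<^sup>2 * (\<Sum>X\<in>?C. ?Q X * ?T (empirical_graphon n X))"
      by (simp add: sum_distrib_left mult.left_commute)
    moreover have "(\<Sum>X\<in>?C. ?Q X * ln (?Q X)) = (?N\<^sup>2 - ?N) / 2 * entropy_fun \<mu>"
      using product_weight_entropy[OF \<mu> n] card_nsets_two[of n] by (simp add: mult.commute)
    ultimately have "?N\<^sup>2 * (\<Sum>X\<in>?C. ?Q X * ?T (empirical_graphon n X)) - (?N\<^sup>2 - ?N) / 2 * entropy_fun \<mu>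
        \<le> ?N\<^sup>2 * free_energy ?T n"
      unfolding free_energy_def using n by simp
    moreover have "(?N\<^sup>2 - ?N) / 2 * entropy_fun \<mu> = ?N\<^sup>2 * ((1 - 1 / ?N) / 2 * entropy_fun \<mu>)"
      using n by (simp add: field_simps power2_eq_square)
    ultimately have "?N\<^sup>2 * ((\<Sum>X\<in>?C. ?Q X * ?T (empirical_graphon n X)) - (1 - 1 / ?N) / 2 * entropy_fun \<mu>)
        \<le> ?N\<^sup>2 * free_energy ?T n"
      by (simp only: right_diff_distrib)
    then have main: "(\<Sum>X\<in>?C. ?Q X * ?T (empirical_graphon n X)) - (1 - 1 / ?N) / 2 * entropy_fun \<mu> \<le> free_energy ?T n"
      using n by (simp add: mult_le_cancel_left)
    have "((?N\<^sup>2 - ?N) * (c \<bullet> \<mu>) + ?N * ?B) / ?N\<^sup>2 = c \<bullet> \<mu> - (c \<bullet> \<mu> - ?B) / ?N"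
      using n by (simp add: field_simps power2_eq_square)
    moreover have "D / ?N = (c \<bullet> \<mu> - ?B) / ?N + (\<Sum>s=1..R. \<gamma> s * (real (card (V s)))\<^sup>2 * ?P s) / ?N - (entropy_fun \<mu> / 2) / ?N"
      unfolding D_def by (simp add: add_divide_distrib diff_divide_distrib)
    moreover have "(1 - 1 / ?N) / 2 * entropy_fun \<mu> = 1 / 2 * entropy_fun \<mu> - (entropy_fun \<mu> / 2) / ?N"
      by (simp add: field_simps)
    ultimately show ?thesis
      using main ET' unfolding scalar_functional_def by linarith
  qed
  then show ?thesis by blast
qed

section \<open>Weak regularity and counting\<close>

type_synonym cut_code = "(real \<times> nat set \<times> nat set) list"

definition cut_sum :: "real \<Rightarrow> cut_code \<Rightarrow> nat \<Rightarrow> nat \<Rightarrow> real" where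
  "cut_sum \<epsilon> s i j = (\<Sum>(\<sigma>, A, B)\<leftarrow>s. \<epsilon> * \<sigma> * of_bool (i \<in> A \<and> j \<in> B))"

definition cut_codes :: "nat \<Rightarrow> nat \<Rightarrow> cut_code set" where
  "cut_codes n N = {s. set s \<subseteq> {-1, 0, 1} \<times> Pow {1..n} \<times> Pow {1..n} \<and> length s = N}"

text \<open>A bound on the cut norm without normalisation, so the relevant thresholds \<eta> are
  small multiples of n^2.\<close>

definition cut_close :: "nat \<Rightarrow> (nat \<Rightarrow> nat \<Rightarrow> real) \<Rightarrow> real \<Rightarrow> bool" where
  "cut_close n d \<eta> \<longleftrightarrow> (\<forall>A B. A \<subseteq> {1..n} \<longrightarrow> B \<subseteq> {1..n} \<longrightarrow> \<bar>\<Sum>i\<in>A. \<Sum>j\<in>B. d i j\<bar> \<le> \<eta>)"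

lemma cut_sum_Cons:
  "cut_sum \<epsilon> ((\<sigma>, A, B) # s) i j = \<epsilon> * \<sigma> * of_bool (i \<in> A \<and> j \<in> B) + cut_sum \<epsilon> s i j"
  by (simp add: cut_sum_def)

text \<open>Greedy energy decrement: as long as some rectangle \<open>A \<times> B\<close> witnesses a discrepancy larger
  than \<open>\<epsilon> n\<^sup>2\<close>, subtracting \<open>\<plusminus>\<epsilon>\<close> on it lowers the squared \<open>L\<^sup>2\<close> norm of the remainder by
  \<open>\<epsilon>\<^sup>2 n\<^sup>2\<close>. The coefficients are always \<open>\<plusminus>\<epsilon>\<close> (or \<open>0\<close>, used for padding), which keeps the set of
  codes finite.\<close>

lemma cut_code_step:
  assumes f: "\<And>i j. \<bar>f i j\<bar> \<le> 1" and \<epsilon>: "\<epsilon> > 0"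
  shows "\<exists>s\<in>cut_codes n m. cut_close n (\<lambda>i j. f i j - cut_sum \<epsilon> s i j) (\<epsilon> * (real n)\<^sup>2) \<or>
    (\<Sum>i=1..n. \<Sum>j=1..n. (f i j - cut_sum \<epsilon> s i j)\<^sup>2) \<le> (real n)\<^sup>2 * (1 - real m * \<epsilon>\<^sup>2)"
proof (induction m)
  case 0
  have "(\<Sum>i=1..n. \<Sum>j=1..n. (f i j)\<^sup>2) \<le> (\<Sum>i=1..n. \<Sum>j=1..n. 1)"
    using f by (intro sum_mono) (simp add: abs_square_le_1)
  then show ?case
    by (intro bexI[of _ "[]"]) (auto simp: cut_sum_def cut_codes_def power2_eq_square)
next
  case (Suc m)
  then obtain s where s: "s \<in> cut_codes n m" and
    "cut_close n (\<lambda>i j. f i j - cut_sum \<epsilon> s i j) (\<epsilon> * (real n)\<^sup>2) \<or>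
      (\<Sum>i=1..n. \<Sum>j=1..n. (f i j - cut_sum \<epsilon> s i j)\<^sup>2) \<le> (real n)\<^sup>2 * (1 - real m * \<epsilon>\<^sup>2)"
    by blast
  then consider (good) "cut_close n (\<lambda>i j. f i j - cut_sum \<epsilon> s i j) (\<epsilon> * (real n)\<^sup>2)"
    | (bad) "\<not> cut_close n (\<lambda>i j. f i j - cut_sum \<epsilon> s i j) (\<epsilon> * (real n)\<^sup>2)"
      "(\<Sum>i=1..n. \<Sum>j=1..n. (f i j - cut_sum \<epsilon> s i j)\<^sup>2) \<le> (real n)\<^sup>2 * (1 - real m * \<epsilon>\<^sup>2)"
    by blast
  then show ?case
  proof cases
    case good
    then show ?thesis
      \<comment> \<open>A rectangle with sign 0 leaves the cut sum unchanged and brings the code to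
        the required length.\<close>
      using s by (intro bexI[of _ "(0, {}, {}) # s"]) (auto simp: cut_sum_Cons cut_codes_def)
  next
    case bad
    define d where "d i j = f i j - cut_sum \<epsilon> s i j" for i j
    obtain A B where AB: "A \<subseteq> {1..n}" "B \<subseteq> {1..n}" and large: "\<epsilon> * (real n)\<^sup>2 < \<bar>\<Sum>i\<in>A. \<Sum>j\<in>B. d i j\<bar>"
      using bad(1) unfolding cut_close_def d_def by (auto simp: not_le)
    define \<sigma> where "\<sigma> = sgn (\<Sum>i\<in>A. \<Sum>j\<in>B. d i j)"
    define r where "r i j = (of_bool (i \<in> A \<and> j \<in> B) :: real)" for i j
    have "0 \<le> \<epsilon> * (real n)\<^sup>2" using \<epsilon> by simp
    then have nz: "(\<Sum>i\<in>A. \<Sum>j\<in>B. d i j) \<noteq> 0" using large by linarith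
    then have \<sigma>: "\<sigma> \<in> {-1, 0, 1}" "\<sigma>\<^sup>2 = 1" "\<sigma> * (\<Sum>i\<in>A. \<Sum>j\<in>B. d i j) = \<bar>\<Sum>i\<in>A. \<Sum>j\<in>B. d i j\<bar>"
      by (auto simp: \<sigma>_def sgn_if)
    have restr: "(\<Sum>i=1..n. \<Sum>j=1..n. r i j * g i j) = (\<Sum>i\<in>A. \<Sum>j\<in>B. g i j)" for g :: "nat \<Rightarrow> nat \<Rightarrow> real"
    proof -
      have r_eq: "r i j * g i j = (if i \<in> A then if j \<in> B then g i j else 0 else 0)" for i j
        by (simp add: r_def)
      have "(\<Sum>i=1..n. \<Sum>j=1..n. r i j * g i j) = (\<Sum>i=1..n. if i \<in> A then (\<Sum>j=1..n. if j \<in> B then g i j else 0) else 0)"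
        by (intro sum.cong refl) (simp add: r_eq)
      then show ?thesis
        using AB by (simp add: sum.If_cases Int_absorb1)
    qed
    have "(\<Sum>i\<in>A. \<Sum>j\<in>B. (1::real)) \<le> (\<Sum>i=1..n. \<Sum>j=1..n. 1)"
      using AB card_mono[OF _ AB(1)] card_mono[OF _ AB(2)] by (simp add: mult_mono)
    then have small: "(\<Sum>i\<in>A. \<Sum>j\<in>B. (1::real)) \<le> (real n)\<^sup>2"
      by (simp add: power2_eq_square)
    \<comment> \<open>The cross term lowers the energy by at least 2 \<epsilon>^2 n^2, and the
      squared correction returns at most \<epsilon>^2 n^2.\<close>
    have "(\<Sum>i=1..n. \<Sum>j=1..n. (d i j - \<epsilon> * \<sigma> * r i j)\<^sup>2) =
        (\<Sum>i=1..n. \<Sum>j=1..n. (d i j)\<^sup>2) - 2 * \<epsilon> * (\<sigma> * (\<Sum>i=1..n. \<Sum>j=1..n. r i j * d i j))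
        + \<epsilon>\<^sup>2 * (\<Sum>i=1..n. \<Sum>j=1..n. r i j * 1)"
    proof -
      have "(d i j - \<epsilon> * \<sigma> * r i j)\<^sup>2 = (d i j)\<^sup>2 - 2 * \<epsilon> * (\<sigma> * (r i j * d i j)) + \<epsilon>\<^sup>2 * (r i j * 1)" for i j
      proof -
        have "(r i j)\<^sup>2 = r i j" by (simp add: r_def)
        then have "(\<epsilon> * \<sigma> * r i j)\<^sup>2 = \<epsilon>\<^sup>2 * (r i j * 1)" using \<sigma>(2) by (simp add: power_mult_distrib)
        then show ?thesis by (simp add: power2_diff)
      qed
      then show ?thesis
        by (simp add: sum.distrib sum_subtractf sum_distrib_left)
    qed
    also have "\<dots> = (\<Sum>i=1..n. \<Sum>j=1..n. (d i j)\<^sup>2) - 2 * \<epsilon> * \<bar>\<Sum>i\<in>A. \<Sum>j\<in>B. d i j\<bar> + \<epsilon>\<^sup>2 * (\<Sum>i\<in>A. \<Sum>j\<in>B. 1)"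
      unfolding restr \<sigma>(3) ..
    also have "\<dots> \<le> (real n)\<^sup>2 * (1 - real m * \<epsilon>\<^sup>2) - 2 * \<epsilon> * (\<epsilon> * (real n)\<^sup>2) + \<epsilon>\<^sup>2 * (real n)\<^sup>2"
    proof (intro add_mono diff_mono)
      show "(\<Sum>i=1..n. \<Sum>j=1..n. (d i j)\<^sup>2) \<le> (real n)\<^sup>2 * (1 - real m * \<epsilon>\<^sup>2)"
        using bad(2) by (simp add: d_def)
      show "2 * \<epsilon> * (\<epsilon> * (real n)\<^sup>2) \<le> 2 * \<epsilon> * \<bar>\<Sum>i\<in>A. \<Sum>j\<in>B. d i j\<bar>"
        using \<epsilon> large by (intro mult_left_mono) auto
      show "\<epsilon>\<^sup>2 * (\<Sum>i\<in>A. \<Sum>j\<in>B. 1) \<le> \<epsilon>\<^sup>2 * (real n)\<^sup>2"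
        using small by (intro mult_left_mono) auto
    qed
    also have "\<dots> = (real n)\<^sup>2 * (1 - real (Suc m) * \<epsilon>\<^sup>2)"
      by (simp add: algebra_simps power2_eq_square)
    finally have "(\<Sum>i=1..n. \<Sum>j=1..n. (f i j - cut_sum \<epsilon> ((\<sigma>, A, B) # s) i j)\<^sup>2) \<le> (real n)\<^sup>2 * (1 - real (Suc m) * \<epsilon>\<^sup>2)"
      by (simp add: cut_sum_Cons d_def r_def algebra_simps)
    moreover have "(\<sigma>, A, B) # s \<in> cut_codes n (Suc m)"
      using s \<sigma>(1) AB by (auto simp: cut_codes_def)
    ultimately show ?thesis by blast
  qed
qed

text \<open>Once N \<epsilon>^2 exceeds 1, the energy alternative would make a sum of squares
  negative.\<close>

lemma weak_regularity:
  assumes f: "\<And>i j. \<bar>f i j\<bar> \<le> 1" and \<epsilon>: "\<epsilon> > 0" "real N * \<epsilon>\<^sup>2 > 1" and n: "n > 0"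
  shows "\<exists>s\<in>cut_codes n N. cut_close n (\<lambda>i j. f i j - cut_sum \<epsilon> s i j) (\<epsilon> * (real n)\<^sup>2)"
proof -
  obtain s where s: "s \<in> cut_codes n N" and
    "cut_close n (\<lambda>i j. f i j - cut_sum \<epsilon> s i j) (\<epsilon> * (real n)\<^sup>2) \<or>
      (\<Sum>i=1..n. \<Sum>j=1..n. (f i j - cut_sum \<epsilon> s i j)\<^sup>2) \<le> (real n)\<^sup>2 * (1 - real N * \<epsilon>\<^sup>2)"
    using cut_code_step[of f \<epsilon> n N] f \<epsilon>(1) by blast
  moreover have "0 \<le> (\<Sum>i=1..n. \<Sum>j=1..n. (f i j - cut_sum \<epsilon> s i j)\<^sup>2)"
    by (intro sum_nonneg) auto
  moreover have "(real n)\<^sup>2 * (1 - real N * \<epsilon>\<^sup>2) < 0"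
    using \<epsilon>(2) n by (simp add: mult_pos_neg)
  ultimately show ?thesis by (meson not_le order_trans)
qed

lemma finite_cut_codes: "finite (cut_codes n N)"
  unfolding cut_codes_def by (intro finite_lists_length_eq) auto

text \<open>For fixed \<open>N\<close> the logarithm is linear in \<open>n\<close>, hence negligible
  against n^2.\<close>

lemma card_cut_codes: "card (cut_codes n N) = (3 * (2 ^ n * 2 ^ n)) ^ N"
proof -
  have "card ({-1, 0, 1 :: real} \<times> Pow {1..n} \<times> Pow {1..n}) = 3 * (2 ^ n * 2 ^ n)"
    unfolding card_cartesian_product by (simp add: card_Pow)
  then show ?thesis
    unfolding cut_codes_def by (subst card_lists_length_eq) auto
qed

lemma cut_close_diff:
  assumes "cut_close n (\<lambda>i j. f i j - h i j) \<eta>" "cut_close n (\<lambda>i j. g i j - h i j) \<eta>"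
  shows "cut_close n (\<lambda>i j. f i j - g i j) (2 * \<eta>)"
  unfolding cut_close_def
proof (intro allI impI)
  fix A B :: "nat set" assume AB: "A \<subseteq> {1..n}" "B \<subseteq> {1..n}"
  have "(\<Sum>i\<in>A. \<Sum>j\<in>B. f i j - g i j) = (\<Sum>i\<in>A. \<Sum>j\<in>B. f i j - h i j) - (\<Sum>i\<in>A. \<Sum>j\<in>B. g i j - h i j)"
    by (simp add: sum_subtractf)
  moreover have "\<bar>\<Sum>i\<in>A. \<Sum>j\<in>B. f i j - h i j\<bar> \<le> \<eta>" "\<bar>\<Sum>i\<in>A. \<Sum>j\<in>B. g i j - h i j\<bar> \<le> \<eta>"
    using assms AB unfolding cut_close_def by blast+
  ultimately show "\<bar>\<Sum>i\<in>A. \<Sum>j\<in>B. f i j - g i j\<bar> \<le> 2 * \<eta>"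
    by linarith
qed

section \<open>The counting lemma: cut norm controls homomorphism densities\<close>

lemma sum_bilinear_le:
  fixes d :: "nat \<Rightarrow> nat \<Rightarrow> real"
  assumes d: "\<And>A B. A \<subseteq> I \<Longrightarrow> B \<subseteq> I \<Longrightarrow> (\<Sum>i\<in>A. \<Sum>j\<in>B. d i j) \<le> \<eta>"
    and I: "finite I"
    and f: "\<And>i. i \<in> I \<Longrightarrow> 0 \<le> f i" "\<And>i. i \<in> I \<Longrightarrow> f i \<le> F"
    and g: "\<And>i. i \<in> I \<Longrightarrow> 0 \<le> g i" "\<And>i. i \<in> I \<Longrightarrow> g i \<le> G"
    and FG: "0 \<le> F" "0 \<le> G"
  shows "(\<Sum>i\<in>I. \<Sum>j\<in>I. d i j * f i * g j) \<le> F * G * \<eta>"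
proof -
  \<comment> \<open>A linear form over weights in [0, H] is largest with weight H where the
    coefficient is positive and 0 elsewhere.\<close>
  have linear: "(\<Sum>i\<in>I. h i * r i) \<le> H * (\<Sum>i\<in>{i \<in> I. r i > 0}. r i)"
    if "\<And>i. i \<in> I \<Longrightarrow> 0 \<le> h i" "\<And>i. i \<in> I \<Longrightarrow> h i \<le> H" for h r :: "nat \<Rightarrow> real" and H
  proof -
    have "(\<Sum>i\<in>I. h i * r i) \<le> (\<Sum>i\<in>I. if r i > 0 then H * r i else 0)"
      using that by (intro sum_mono) (auto intro!: mult_right_mono mult_nonneg_nonpos)
    also have "\<dots> = H * (\<Sum>i\<in>{i \<in> I. r i > 0}. r i)"
      using I by (simp add: sum.If_cases Int_def sum_distrib_left)
    finally show ?thesis .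
  qed
  \<comment> \<open>Rounding the row weights selects \<open>A\<close>, then rounding the column
    weights selects \<open>B\<close>; what remains is a rectangle sum of \<open>d\<close>.\<close>
  define A where "A = {i \<in> I. (\<Sum>j\<in>I. d i j * g j) > 0}"
  define B where "B = {j \<in> I. (\<Sum>i\<in>A. d i j) > 0}"
  have "(\<Sum>i\<in>I. \<Sum>j\<in>I. d i j * f i * g j) = (\<Sum>i\<in>I. f i * (\<Sum>j\<in>I. d i j * g j))"
    by (simp add: sum_distrib_left mult_ac)
  also have "\<dots> \<le> F * (\<Sum>i\<in>A. \<Sum>j\<in>I. d i j * g j)"
    unfolding A_def using f by (rule linear)
  also have "(\<Sum>i\<in>A. \<Sum>j\<in>I. d i j * g j) = (\<Sum>j\<in>I. g j * (\<Sum>i\<in>A. d i j))"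
    by (subst sum.swap) (simp add: sum_distrib_left mult.commute)
  also have "F * \<dots> \<le> F * (G * (\<Sum>j\<in>B. \<Sum>i\<in>A. d i j))"
    unfolding B_def using g FG by (intro mult_left_mono linear)
  also have "(\<Sum>j\<in>B. \<Sum>i\<in>A. d i j) = (\<Sum>i\<in>A. \<Sum>j\<in>B. d i j)"
    by (rule sum.swap)
  also have "F * (G * \<dots>) \<le> F * (G * \<eta>)"
    using FG by (intro mult_left_mono d) (auto simp: A_def B_def)
  finally show ?thesis by (simp add: mult.assoc)
qed

context
  fixes V :: "'v::linorder set" and E :: "'v set set" and n :: nat and M :: real
  assumes G: "simple_graph V E" and M: "0 \<le> M"
begin

text \<open>Fix all vertices except the ends v, w of \<open>e0\<close>. No other edge contains both,
  so the remaining product splits into a function of the value at v times one of the value at w, and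
  the bilinear bound applies. The factor n^2 comes from resampling the two ends.\<close>

lemma sum_single_edge_le:
  fixes d :: "nat \<Rightarrow> nat \<Rightarrow> real" and q :: "'v set \<Rightarrow> nat \<Rightarrow> nat \<Rightarrow> real"
  assumes d: "\<And>A B. A \<subseteq> {1..n} \<Longrightarrow> B \<subseteq> {1..n} \<Longrightarrow> (\<Sum>i\<in>A. \<Sum>j\<in>B. d i j) \<le> \<eta>"
    and e0: "e0 \<in> E"
    and q: "\<And>e i j. i \<in> {1..n} \<Longrightarrow> j \<in> {1..n} \<Longrightarrow> 0 \<le> q e i j" "\<And>e i j. i \<in> {1..n} \<Longrightarrow> j \<in> {1..n} \<Longrightarrow> q e i j \<le> M"
  shows "(real n)\<^sup>2 * (\<Sum>z\<in>V \<rightarrow>\<^sub>E {1..n}. d (z (Min e0)) (z (Max e0)) * (\<Prod>e\<in>E - {e0}. q e (z (Min e)) (z (Max e))))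
    \<le> real n ^ card V * (M ^ (card E - 1) * \<eta>)"
proof -
  let ?Z = "V \<rightarrow>\<^sub>E {1..n}"
  define v w where "v = Min e0" and "w = Max e0"
  note ends = simple_graphD(3-4)[OF G]
  have vw: "v \<in> V" "w \<in> V" "v \<noteq> w" "e0 = {v, w}"
    using simple_graphD(3-6)[OF G e0] unfolding v_def w_def by blast+
  define F where "F z = d (z v) (z w) * (\<Prod>e\<in>E - {e0}. q e (z (Min e)) (z (Max e)))" for z
  define E1 where "E1 = {e \<in> E - {e0}. w \<notin> e}"
  define E2 where "E2 = {e \<in> E - {e0}. w \<in> e}"
  have E12: "E - {e0} = E1 \<union> E2" "E1 \<inter> E2 = {}" "finite E1" "finite E2"
    using simple_graphD(2)[OF G] by (auto simp: E1_def E2_def)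
  have mem: "Min e \<in> e" "Max e \<in> e" if "e \<in> E" for e
    using simple_graphD(6)[OF G that] by (metis insertCI)+
  have E1w: "Min e \<noteq> w" "Max e \<noteq> w" if "e \<in> E1" for e
    using mem[of e] that by (auto simp: E1_def)
  have E2v: "Min e \<noteq> v" "Max e \<noteq> v" if "e \<in> E2" for e
  proof -
    have e: "e \<in> E" "e \<noteq> e0" "w \<in> e" using that by (auto simp: E2_def)
    have "v \<notin> e"
      using e simple_graphD(6)[OF G e(1)] vw(3,4) by (metis insertE insert_commute singletonD)
    then show "Min e \<noteq> v" "Max e \<noteq> v" using mem[OF e(1)] by auto
  qed
  have "(real n)\<^sup>2 * (\<Sum>z\<in>?Z. F z) = real n * (real n * (\<Sum>z\<in>?Z. F z))"
    by (simp add: power2_eq_square)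
  also have "real n * (\<Sum>z\<in>?Z. F z) = (\<Sum>z\<in>?Z. \<Sum>j\<in>{1..n}. F (z(w := j)))"
    using sum_PiE_fun_upd[of "{1..n}" w V F] vw by simp
  also have "real n * \<dots> = (\<Sum>z\<in>?Z. \<Sum>i\<in>{1..n}. \<Sum>j\<in>{1..n}. F (z(v := i, w := j)))"
    using sum_PiE_fun_upd[of "{1..n}" v V "\<lambda>z. \<Sum>j\<in>{1..n}. F (z(w := j))"] vw by simp
  also have "\<dots> \<le> (\<Sum>z\<in>?Z. M ^ (card E - 1) * \<eta>)"
  proof (rule sum_mono)
    fix z assume z: "z \<in> ?Z"
    define f where "f i = (\<Prod>e\<in>E1. q e ((z(v := i)) (Min e)) ((z(v := i)) (Max e)))" for i
    define g where "g j = (\<Prod>e\<in>E2. q e ((z(w := j)) (Min e)) ((z(w := j)) (Max e)))" for j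
    have "F (z(v := i, w := j)) = d i j * f i * g j" for i j
    proof -
      have "(\<Prod>e\<in>E1. q e ((z(v := i, w := j)) (Min e)) ((z(v := i, w := j)) (Max e))) = f i"
        unfolding f_def using E1w by (intro prod.cong refl) simp
      moreover have "(\<Prod>e\<in>E2. q e ((z(v := i, w := j)) (Min e)) ((z(v := i, w := j)) (Max e))) = g j"
        unfolding g_def using E2v by (intro prod.cong refl) simp
      ultimately show ?thesis
        unfolding F_def E12(1) using E12(2-4) vw(3) by (simp add: prod.union_disjoint)
    qed
    then have "(\<Sum>i\<in>{1..n}. \<Sum>j\<in>{1..n}. F (z(v := i, w := j))) = (\<Sum>i\<in>{1..n}. \<Sum>j\<in>{1..n}. d i j * f i * g j)"
      by simp
    also have "\<dots> \<le> M ^ card E1 * M ^ card E2 * \<eta>"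
    proof (rule sum_bilinear_le[OF d])
      have upd: "(z(x := i)) (Min e) \<in> {1..n}" "(z(x := i)) (Max e) \<in> {1..n}" if "i \<in> {1..n}" "e \<in> E" for x i e
        using z that ends[of e] by (auto simp: PiE_iff)
      have E: "e \<in> E" if "e \<in> E1 \<or> e \<in> E2" for e using that by (auto simp: E1_def E2_def)
      show "0 \<le> f i" "f i \<le> M ^ card E1" if "i \<in> {1..n}" for i
        unfolding f_def using q upd[OF that E] prod_mono[of E1 _ "\<lambda>_. M"] by (auto intro!: prod_nonneg)
      show "0 \<le> g i" "g i \<le> M ^ card E2" if "i \<in> {1..n}" for i
        unfolding g_def using q upd[OF that E] prod_mono[of E2 _ "\<lambda>_. M"] by (auto intro!: prod_nonneg)
    qed (use M in auto)
    also have "M ^ card E1 * M ^ card E2 = M ^ (card E - 1)"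
    proof -
      have "card E1 + card E2 = card (E - {e0})"
        using E12 by (simp add: card_Un_disjoint)
      then show ?thesis
        using e0 by (simp add: power_add[symmetric])
    qed
    finally show "(\<Sum>i\<in>{1..n}. \<Sum>j\<in>{1..n}. F (z(v := i, w := j))) \<le> M ^ (card E - 1) * \<eta>" .
  qed
  also have "\<dots> = real n ^ card V * (M ^ (card E - 1) * \<eta>)"
    using simple_graphD(1)[OF G] by (simp add: card_PiE)
  finally show ?thesis unfolding F_def v_def w_def .
qed

text \<open>A telescoping sum over the edges: each exchange of \<open>u'\<close> for
  \<open>u\<close> on a single edge costs at most the bound of the previous lemma.\<close>

lemma discrete_density_le:
  fixes u u' :: "nat \<Rightarrow> nat \<Rightarrow> real"
  assumes d: "\<And>A B. A \<subseteq> {1..n} \<Longrightarrow> B \<subseteq> {1..n} \<Longrightarrow> (\<Sum>i\<in>A. \<Sum>j\<in>B. u' i j - u i j) \<le> \<eta> * (real n)\<^sup>2"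
    and u: "\<And>i j. 0 \<le> u i j" "\<And>i j. u i j \<le> M" and u': "\<And>i j. 0 \<le> u' i j" "\<And>i j. u' i j \<le> M"
    and n: "n > 0"
  shows "discrete_density V E n u' \<le> discrete_density V E n u + real (card E) * M ^ (card E - 1) * \<eta>"
proof -
  let ?Z = "V \<rightarrow>\<^sub>E {1..n}"
  \<comment> \<open>\<open>F\<close> collects the edges already exchanged: up to normalisation,
    \<open>h {}\<close> below is the density of \<open>u'\<close> and \<open>h E\<close> that of
    \<open>u\<close>.\<close>
  define q where "q F e = (if e \<in> F then u else u')" for F and e :: "'v set"
  define h where "h F = (\<Sum>z\<in>?Z. \<Prod>e\<in>E. q F e (z (Min e)) (z (Max e)))" for F
  have finE: "finite E" by (rule simple_graphD(2)[OF G])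
  have step: "h F \<le> h (insert e0 F) + real n ^ card V * (M ^ (card E - 1) * \<eta>)" if e0: "e0 \<in> E" "e0 \<notin> F" for F e0
  proof -
    have split: "(\<Prod>e\<in>E. q F' e (z (Min e)) (z (Max e))) =
        q F' e0 (z (Min e0)) (z (Max e0)) * (\<Prod>e\<in>E - {e0}. q F' e (z (Min e)) (z (Max e)))" for F' z
      using finE e0(1) by (rule prod.remove)
    have same: "(\<Prod>e\<in>E - {e0}. q (insert e0 F) e (z (Min e)) (z (Max e))) = (\<Prod>e\<in>E - {e0}. q F e (z (Min e)) (z (Max e)))" for z
      by (intro prod.cong refl) (auto simp: q_def)
    have "h F - h (insert e0 F) = (\<Sum>z\<in>?Z. (u' (z (Min e0)) (z (Max e0)) - u (z (Min e0)) (z (Max e0))) *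
        (\<Prod>e\<in>E - {e0}. q F e (z (Min e)) (z (Max e))))"
      unfolding h_def split same sum_subtractf[symmetric] using e0(2)
      by (intro sum.cong refl) (simp add: q_def left_diff_distrib)
    then have "(real n)\<^sup>2 * (h F - h (insert e0 F)) \<le> real n ^ card V * (M ^ (card E - 1) * (\<eta> * (real n)\<^sup>2))"
      using sum_single_edge_le[OF d e0(1), of "q F"] u u' by (simp add: q_def)
    then have "(real n)\<^sup>2 * (h F - h (insert e0 F)) \<le> (real n)\<^sup>2 * (real n ^ card V * (M ^ (card E - 1) * \<eta>))"
      by (simp add: mult_ac)
    then have "h F - h (insert e0 F) \<le> real n ^ card V * (M ^ (card E - 1) * \<eta>)"
      using n by (simp add: mult_le_cancel_left)
    then show ?thesis by simp
  qed
  have "h {} \<le> h F + real (card F) * (real n ^ card V * (M ^ (card E - 1) * \<eta>))" if "F \<subseteq> E" for F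
    using finite_subset[OF that finE] that
  proof (induction F rule: finite_induct)
    case (insert e0 F)
    then show ?case using step[of e0 F] by (simp add: algebra_simps)
  qed simp
  from this[of E] have "h {} \<le> h E + real (card E) * (real n ^ card V * (M ^ (card E - 1) * \<eta>))" by simp
  then have "h {} / real n ^ card V \<le> (h E + real (card E) * (real n ^ card V * (M ^ (card E - 1) * \<eta>))) / real n ^ card V"
    by (rule divide_right_mono) simp
  moreover have "h {} / real n ^ card V = discrete_density V E n u'" "h E / real n ^ card V = discrete_density V E n u"
    by (simp_all add: h_def q_def discrete_density_def)
  ultimately show ?thesis
    using n by (simp add: add_divide_distrib mult.assoc)
qed

end

section \<open>Clusters of colourings in cut norm\<close>

lemma cut_close_inner:
  fixes D :: "nat \<Rightarrow> nat \<Rightarrow> real ^ 'k::finite"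
  assumes close: "\<And>a. cut_close n (\<lambda>i j. D i j $ a) \<eta>"
  shows "cut_close n (\<lambda>i j. c \<bullet> D i j) ((\<Sum>a\<in>UNIV. \<bar>c $ a\<bar>) * \<eta>)"
  unfolding cut_close_def
proof (intro allI impI)
  fix A B :: "nat set" assume AB: "A \<subseteq> {1..n}" "B \<subseteq> {1..n}"
  have "(\<Sum>i\<in>A. \<Sum>j\<in>B. c \<bullet> D i j) = c \<bullet> (\<Sum>i\<in>A. \<Sum>j\<in>B. D i j)"
    by (simp add: inner_sum_right)
  also have "\<dots> = (\<Sum>a\<in>UNIV. c $ a * (\<Sum>i\<in>A. \<Sum>j\<in>B. D i j $ a))"
    by (simp add: inner_vec_def)
  also have "\<bar>\<dots>\<bar> \<le> (\<Sum>a\<in>UNIV. \<bar>c $ a * (\<Sum>i\<in>A. \<Sum>j\<in>B. D i j $ a)\<bar>)"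
    by (rule sum_abs)
  also have "\<dots> \<le> (\<Sum>a\<in>UNIV. \<bar>c $ a\<bar> * \<eta>)"
    unfolding abs_mult using close AB by (intro sum_mono mult_left_mono) (auto simp: cut_close_def)
  finally show "\<bar>\<Sum>i\<in>A. \<Sum>j\<in>B. c \<bullet> D i j\<bar> \<le> (\<Sum>a\<in>UNIV. \<bar>c $ a\<bar>) * \<eta>"
    by (simp add: sum_distrib_right)
qed

text \<open>Balls in the cut norm are convex: the difference to the mean is the average of the
  differences to the members.\<close>

lemma cut_close_mean_matrix:
  assumes "finite \<A>" "\<A> \<noteq> {}"
    and close: "\<And>Y. Y \<in> \<A> \<Longrightarrow> cut_close n (\<lambda>i j. empirical_matrix n X i j $ a - empirical_matrix n Y i j $ a) \<eta>"
  shows "cut_close n (\<lambda>i j. (empirical_matrix n X i j - mean_matrix n \<A> i j) $ a) \<eta>"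
  unfolding cut_close_def
proof (intro allI impI)
  fix A B :: "nat set" assume AB: "A \<subseteq> {1..n}" "B \<subseteq> {1..n}"
  let ?e = "\<lambda>X i j. empirical_matrix n X i j $ a"
  have pos: "real (card \<A>) > 0" using assms by (simp add: card_gt_0_iff)
  have "(empirical_matrix n X i j - mean_matrix n \<A> i j) $ a = (\<Sum>Y\<in>\<A>. ?e X i j - ?e Y i j) / real (card \<A>)" for i j
    using pos by (simp add: mean_matrix_def sum_subtractf diff_divide_distrib)
  then have "(\<Sum>i\<in>A. \<Sum>j\<in>B. (empirical_matrix n X i j - mean_matrix n \<A> i j) $ a) =
      (\<Sum>i\<in>A. \<Sum>j\<in>B. \<Sum>Y\<in>\<A>. ?e X i j - ?e Y i j) / real (card \<A>)"
    by (simp add: sum_divide_distrib)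
  also have "(\<Sum>i\<in>A. \<Sum>j\<in>B. \<Sum>Y\<in>\<A>. ?e X i j - ?e Y i j) = (\<Sum>i\<in>A. \<Sum>Y\<in>\<A>. \<Sum>j\<in>B. ?e X i j - ?e Y i j)"
    by (intro sum.cong refl sum.swap)
  also have "\<dots> = (\<Sum>Y\<in>\<A>. \<Sum>i\<in>A. \<Sum>j\<in>B. ?e X i j - ?e Y i j)"
    by (rule sum.swap)
  finally have eq: "(\<Sum>i\<in>A. \<Sum>j\<in>B. (empirical_matrix n X i j - mean_matrix n \<A> i j) $ a) =
      (\<Sum>Y\<in>\<A>. \<Sum>i\<in>A. \<Sum>j\<in>B. ?e X i j - ?e Y i j) / real (card \<A>)" .
  have "\<bar>\<Sum>Y\<in>\<A>. \<Sum>i\<in>A. \<Sum>j\<in>B. ?e X i j - ?e Y i j\<bar> \<le> (\<Sum>Y\<in>\<A>. \<bar>\<Sum>i\<in>A. \<Sum>j\<in>B. ?e X i j - ?e Y i j\<bar>)"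
    by (rule sum_abs)
  also have "\<dots> \<le> (\<Sum>Y\<in>\<A>. \<eta>)"
    using close AB by (intro sum_mono) (auto simp: cut_close_def)
  finally show "\<bar>\<Sum>i\<in>A. \<Sum>j\<in>B. (empirical_matrix n X i j - mean_matrix n \<A> i j) $ a\<bar> \<le> \<eta>"
    unfolding eq using pos by (simp add: field_simps)
qed

text \<open>One code is chosen for each colour class. Colourings with the same codes are within
  \<epsilon> of the same cut sums, hence within 2 \<epsilon> of each other.\<close>

lemma cut_codes_cover:
  fixes \<epsilon> :: real
  assumes "\<epsilon> > 0" "real N * \<epsilon>\<^sup>2 > 1" "n > 0"
  obtains \<phi> :: "(nat set \<Rightarrow> 'k::finite) \<Rightarrow> 'k \<Rightarrow> cut_code"
  where "\<And>X a. \<phi> X a \<in> cut_codes n N"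
    and "\<And>X Y a. \<phi> X = \<phi> Y \<Longrightarrow>
      cut_close n (\<lambda>i j. empirical_matrix n X i j $ a - empirical_matrix n Y i j $ a) (2 * \<epsilon> * (real n)\<^sup>2)"
proof -
  let ?good = "\<lambda>X a s. s \<in> cut_codes n N \<and>
    cut_close n (\<lambda>i j. empirical_matrix n X i j $ a - cut_sum \<epsilon> s i j) (\<epsilon> * (real n)\<^sup>2)"
  define \<phi> :: "(nat set \<Rightarrow> 'k) \<Rightarrow> 'k \<Rightarrow> cut_code" where "\<phi> X a = (SOME s. ?good X a s)" for X a
  have "\<exists>s. ?good X a s" for X and a :: 'k
  proof -
    have "\<bar>empirical_matrix n X i j $ a\<bar> \<le> 1" for i j
      using prob_simplexD(1,2)[OF empirical_matrix_in_prob_simplex, of n X i j a] by simp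
    then show ?thesis using weak_regularity[of "\<lambda>i j. empirical_matrix n X i j $ a" \<epsilon> N n] assms by blast
  qed
  then have \<phi>: "?good X a (\<phi> X a)" for X a
    unfolding \<phi>_def by (rule someI_ex)
  show ?thesis
  proof (rule that)
    show "\<phi> X a \<in> cut_codes n N" for X a using \<phi> by blast
    fix X Y a assume eq: "\<phi> X = \<phi> Y"
    show "cut_close n (\<lambda>i j. empirical_matrix n X i j $ a - empirical_matrix n Y i j $ a) (2 * \<epsilon> * (real n)\<^sup>2)"
      using cut_close_diff[OF conjunct2[OF \<phi>[of X a]]] conjunct2[OF \<phi>[of Y a]] eq by (simp add: mult.assoc)
  qed
qed

section \<open>The free energy and its maximizers\<close>

context
  fixes c :: "real ^ 'k::finite" and R :: nat and \<gamma> :: "nat \<Rightarrow> real" and \<alpha> :: "nat \<Rightarrow> real ^ 'k"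
    and V :: "nat \<Rightarrow> 'v::linorder set" and E :: "nat \<Rightarrow> 'v set set"
  assumes G: "\<And>s. s \<in> {1..R} \<Longrightarrow> simple_graph (V s) (E s) \<and> E s \<noteq> {}"
    and \<alpha>: "\<And>s a. s \<in> {1..R} \<Longrightarrow> \<alpha> s $ a \<ge> 0"
    and \<gamma>: "\<And>s. s \<in> {1..R} \<Longrightarrow> \<gamma> s \<ge> 0"
begin

private abbreviation (input) T where "T \<equiv> graphon_hamiltonian c R \<gamma> \<alpha> V E"
private abbreviation (input) L where "L \<equiv> scalar_functional c R \<gamma> \<alpha> E"
private abbreviation (input) S where "S \<equiv> SUP \<mu>\<in>prob_simplex. L \<mu>"

section \<open>The variational problem over graphons\<close>

lemma integrable_scalar_functional:
  assumes "W \<in> graphons"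
  shows "integrable unit_square (\<lambda>p. scalar_functional c R \<gamma> \<alpha> E (W p))"
  unfolding scalar_functional_def
  by (intro Bochner_Integration.integrable_diff Bochner_Integration.integrable_add
      Bochner_Integration.integrable_sum integrable_mult_right graphons_integrable[OF assms])

text \<open>The linear and entropy parts agree exactly, so the gap is a nonnegative combination of
  the defects in the mean inequality; the equality analysis can treat each graph separately.\<close>

lemma hamiltonian_gap:
  assumes W: "W \<in> graphons"
  shows "(LINT p|unit_square. scalar_functional c R \<gamma> \<alpha> E (W p))
      - (graphon_hamiltonian c R \<gamma> \<alpha> V E W - 1 / 2 * graphon_entropy W)
    = (\<Sum>s=1..R. \<gamma> s * ((LINT p|unit_square. (\<alpha> s \<bullet> W p) ^ card (E s)) - hom_density (V s) (E s) (\<lambda>p. \<alpha> s \<bullet> W p)))"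
proof -
  note int = graphons_integrable[OF W]
  have "(LINT p|unit_square. L (W p)) = (LINT p|unit_square. c \<bullet> W p)
      + (\<Sum>s=1..R. \<gamma> s * (LINT p|unit_square. (\<alpha> s \<bullet> W p) ^ card (E s))) - 1 / 2 * graphon_entropy W"
    unfolding scalar_functional_def graphon_entropy_def using int by simp
  then show ?thesis
    unfolding graphon_hamiltonian_def edge_density_eq[OF graphons_measurable(1)[OF W]]
    by (simp add: sum_subtractf right_diff_distrib)
qed

private lemma hom_density_le:
  assumes "W \<in> graphons" "s \<in> {1..R}"
  shows "0 \<le> \<gamma> s * ((LINT p|unit_square. (\<alpha> s \<bullet> W p) ^ card (E s)) - hom_density (V s) (E s) (\<lambda>p. \<alpha> s \<bullet> W p))"
  using G[OF assms(2)] \<alpha>[OF assms(2)] \<gamma>[OF assms(2)] hom_density_graphon(1)[OF assms(1), of "V s" "E s" "\<alpha> s"]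
  by simp

lemma hamiltonian_le_integral:
  assumes W: "W \<in> graphons"
  shows "graphon_hamiltonian c R \<gamma> \<alpha> V E W - 1 / 2 * graphon_entropy W
    \<le> (LINT p|unit_square. scalar_functional c R \<gamma> \<alpha> E (W p))"
proof -
  have "0 \<le> (\<Sum>s=1..R. \<gamma> s * ((LINT p|unit_square. (\<alpha> s \<bullet> W p) ^ card (E s)) - hom_density (V s) (E s) (\<lambda>p. \<alpha> s \<bullet> W p)))"
    by (intro sum_nonneg hom_density_le W)
  then show ?thesis
    using hamiltonian_gap[OF W] by linarith
qed

lemma integral_scalar_functional_le:
  assumes W: "W \<in> graphons"
  shows "(LINT p|unit_square. scalar_functional c R \<gamma> \<alpha> E (W p)) \<le> S"
proof -
  have "(LINT p|unit_square. L (W p)) \<le> (LINT p|unit_square. S)"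
    using graphons_in_prob_simplex[OF W]
    by (intro integral_mono integrable_scalar_functional W scalar_functional_le_SUP) auto
  then show ?thesis using unit2.prob_space by simp
qed

lemma hamiltonian_le_SUP:
  assumes W: "W \<in> graphons"
  shows "graphon_hamiltonian c R \<gamma> \<alpha> V E W - 1 / 2 * graphon_entropy W
    \<le> (SUP \<mu>\<in>prob_simplex. scalar_functional c R \<gamma> \<alpha> E \<mu>)"
  using hamiltonian_le_integral[OF W] integral_scalar_functional_le[OF W] by linarith

lemma hamiltonian_const:
  "graphon_hamiltonian c R \<gamma> \<alpha> V E (\<lambda>_. \<mu>) - 1 / 2 * graphon_entropy (\<lambda>_. \<mu>) = scalar_functional c R \<gamma> \<alpha> E \<mu>"
proof -
  have "hom_density (V s) (E s) (\<lambda>_. u) = u ^ card (E s)" if "s \<in> {1..R}" for s u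
    using G[OF that] by (intro hom_density_const simple_graphD(1)) auto
  then show ?thesis
    using unit2.prob_space
    by (simp add: graphon_hamiltonian_def scalar_functional_def graphon_entropy_def edge_density_def hom_density_const)
qed

text \<open>On the fibres of \<open>\<mu> \<mapsto> \<alpha> s \<bullet> \<mu>\<close> (for the \<open>s\<close> that contribute nonlinearly) the
  functional is the sum of an affine function and the strictly concave \<open>- 1 / 2 * entropy_fun\<close>.\<close>

lemma scalar_functional_maximizer_unique_on_fibre:
  assumes "\<mu> \<in> prob_simplex" "\<nu> \<in> prob_simplex" "L \<mu> = S" "L \<nu> = S"
    and fibre: "\<And>s. s \<in> {1..R} \<Longrightarrow> \<gamma> s \<noteq> 0 \<Longrightarrow> card (E s) \<ge> 2 \<Longrightarrow> \<alpha> s \<bullet> \<mu> = \<alpha> s \<bullet> \<nu>"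
  shows "\<mu> = \<nu>"
proof (rule ccontr)
  assume ne: "\<mu> \<noteq> \<nu>"
  let ?m = "(1 / 2) *\<^sub>R (\<mu> + \<nu>)"
  have inner: "a \<bullet> ?m = (a \<bullet> \<mu> + a \<bullet> \<nu>) / 2" for a
    by (simp add: inner_add_right)
  have "\<gamma> s * (\<alpha> s \<bullet> ?m) ^ card (E s) = (\<gamma> s * (\<alpha> s \<bullet> \<mu>) ^ card (E s) + \<gamma> s * (\<alpha> s \<bullet> \<nu>) ^ card (E s)) / 2"
    if s: "s \<in> {1..R}" for s
  proof -
    have "card (E s) \<noteq> 0"
      using G[OF s] simple_graphD(2)[of "V s" "E s"] by auto
    \<comment> \<open>A vanishing weight contributes nothing, a single edge gives an affine term,
      and in the last case the fibre condition makes the three values equal.\<close>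
    then consider "\<gamma> s = 0" | "card (E s) = 1" | "\<gamma> s \<noteq> 0" "card (E s) \<ge> 2" by linarith
    then show ?thesis
    proof cases
      case 2
      then show ?thesis unfolding inner by (simp add: field_simps)
    next
      case 3
      then show ?thesis unfolding inner using fibre[OF s 3] by simp
    qed simp
  qed
  then have "(\<Sum>s=1..R. \<gamma> s * (\<alpha> s \<bullet> ?m) ^ card (E s)) =
      ((\<Sum>s=1..R. \<gamma> s * (\<alpha> s \<bullet> \<mu>) ^ card (E s)) + (\<Sum>s=1..R. \<gamma> s * (\<alpha> s \<bullet> \<nu>) ^ card (E s))) / 2"
    unfolding sum.distrib[symmetric] sum_divide_distrib by (intro sum.cong) auto
  moreover have "((x + y - 1 / 2 * z) + (x' + y' - 1 / 2 * z')) / 2 < x'' + y'' - 1 / 2 * z''"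
    if "y'' = (y + y') / 2" "x'' = (x + x') / 2" "z'' < (z + z') / 2" for x x' x'' y y' y'' z z' z'' :: real
    using that by (simp add: field_simps)
  ultimately have "(L \<mu> + L \<nu>) / 2 < L ?m"
    using entropy_fun_midpoint_less[OF assms(1,2) ne] inner[of c]
    unfolding scalar_functional_def by blast
  moreover have "L ?m \<le> S"
    by (intro scalar_functional_le_SUP midpoint_in_prob_simplex assms)
  ultimately show False using assms(3,4) by simp
qed

text \<open>Constant graphons force the chain S \<le> T W - I W / 2 \<le> integral of
  \<open>L (W p)\<close> \<le> S to consist of equalities. The middle one makes every defect 0, the
  last one puts almost every value of \<open>W\<close> among the maximizers of \<open>L\<close>.
  That the supremum is attained comes out of the argument.\<close>

lemma maximizer_constant:
  assumes max: "is_arg_max (\<lambda>W. graphon_hamiltonian c R \<gamma> \<alpha> V E W - 1 / 2 * graphon_entropy W) (\<lambda>W. W \<in> graphons) W"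
  shows "\<exists>\<mu>\<in>prob_simplex.
    scalar_functional c R \<gamma> \<alpha> E \<mu> = (SUP \<nu>\<in>prob_simplex. scalar_functional c R \<gamma> \<alpha> E \<nu>) \<and>
    (AE p in unit_square. W p = \<mu>)"
proof -
  have W: "W \<in> graphons"
    using max by (simp add: is_arg_max_def)
  have ge: "L \<mu> \<le> T W - 1 / 2 * graphon_entropy W" if "\<mu> \<in> prob_simplex" for \<mu>
    using max const_in_graphons[OF that] hamiltonian_const[of \<mu>]
    by (metis (no_types, lifting) is_arg_max_def not_le)
  have "S \<le> T W - 1 / 2 * graphon_entropy W"
    using ge uniform_in_prob_simplex by (intro cSUP_least) auto
  then have int_eq: "(LINT p|unit_square. L (W p)) = S"
    and gap: "(LINT p|unit_square. L (W p)) - (T W - 1 / 2 * graphon_entropy W) = 0"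
    using hamiltonian_le_integral[OF W] integral_scalar_functional_le[OF W] by linarith+
  have "(LINT p|unit_square. S - L (W p)) = 0"
    using integrable_scalar_functional[OF W] int_eq unit2.prob_space by simp
  then have "AE p in unit_square. S - L (W p) = 0"
    using integrable_scalar_functional[OF W] scalar_functional_le_SUP[OF graphons_in_prob_simplex[OF W]]
    by (subst (asm) integral_nonneg_eq_0_iff_AE) (auto intro!: AE_I2)
  then have AE_L: "AE p in unit_square. L (W p) = S"
    by (rule eventually_mono) simp
  let ?gap = "\<lambda>s. (LINT p|unit_square. (\<alpha> s \<bullet> W p) ^ card (E s)) - hom_density (V s) (E s) (\<lambda>p. \<alpha> s \<bullet> W p)"
  have "(\<Sum>s=1..R. \<gamma> s * ?gap s) = 0"
    using gap hamiltonian_gap[OF W] by simp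
  then have gap0: "\<gamma> s * ?gap s = 0" if "s \<in> {1..R}" for s
    using hom_density_le[OF W] that by (subst (asm) sum_nonneg_eq_0_iff) auto
  \<comment> \<open>Only these graphs constrain \<open>W\<close>: for a single edge the defect is 0
    for every graphon.\<close>
  let ?A = "{s \<in> {1..R}. \<gamma> s \<noteq> 0 \<and> card (E s) \<ge> 2}"
  have "\<forall>s\<in>?A. \<exists>\<kappa>. AE p in unit_square. \<alpha> s \<bullet> W p = \<kappa>"
  proof
    fix s assume s: "s \<in> ?A"
    then have "?gap s = 0" using gap0[of s] by auto
    then show "\<exists>\<kappa>. AE p in unit_square. \<alpha> s \<bullet> W p = \<kappa>"
      using s G \<alpha> by (intro hom_density_graphon(2)[OF W, of "V s" "E s"]) auto
  qed
  from bchoice[OF this] obtain \<kappa> where "\<forall>s\<in>?A. AE p in unit_square. \<alpha> s \<bullet> W p = \<kappa> s" ..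
  then have "AE p in unit_square. \<forall>s\<in>?A. \<alpha> s \<bullet> W p = \<kappa> s"
    by (intro AE_finite_allI) auto
  with AE_L have good: "AE p in unit_square. L (W p) = S \<and> (\<forall>s\<in>?A. \<alpha> s \<bullet> W p = \<kappa> s) \<and> W p \<in> prob_simplex"
    using AE_space by eventually_elim (use graphons_in_prob_simplex[OF W] in auto)
  then obtain q where q: "L (W q) = S" "\<forall>s\<in>?A. \<alpha> s \<bullet> W q = \<kappa> s" "W q \<in> prob_simplex"
    using eventually_happens' unit2.ae_filter_bot by blast
  have "AE p in unit_square. W p = W q"
    using good
  proof eventually_elim
    case (elim p)
    then show ?case
      using q by (intro scalar_functional_maximizer_unique_on_fibre) auto
  qed
  then show ?thesis using q by blast
qed

section \<open>The upper bound for the free energy\<close>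

lemma hamiltonian_lipschitz:
  "\<exists>C\<ge>0. \<forall>n>0. \<forall>w w' \<eta>. (\<forall>i j. w i j \<in> prob_simplex \<and> w' i j \<in> prob_simplex) \<longrightarrow>
    (\<forall>a. cut_close n (\<lambda>i j. (w' i j - w i j) $ a) (\<eta> * (real n)\<^sup>2)) \<longrightarrow>
    graphon_hamiltonian c R \<gamma> \<alpha> V E (step_graphon n w') \<le> graphon_hamiltonian c R \<gamma> \<alpha> V E (step_graphon n w) + C * \<eta>"
proof -
  define cs where "cs = (\<Sum>a\<in>UNIV. \<bar>c $ a\<bar>)"
  define M where "M s = (\<Sum>a\<in>UNIV. \<bar>\<alpha> s $ a\<bar>)" for s
  \<comment> \<open>Each density costs \<open>card (E s)\<close> exchanges, the other edges being
    bounded by \<open>M s\<close>; the last factor \<open>M s\<close> passes from the colour classes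
    to their combination with coefficients \<open>\<alpha> s\<close>. Nothing depends on
    \<open>n\<close>.\<close>
  define C where "C = cs + (\<Sum>s=1..R. \<gamma> s * (real (card (E s)) * M s ^ (card (E s) - 1) * M s))"
  have M0: "0 \<le> M s" for s unfolding M_def by (intro sum_nonneg) auto
  have "C \<ge> 0"
    unfolding C_def cs_def using \<gamma> M0 by (intro add_nonneg_nonneg sum_nonneg mult_nonneg_nonneg) auto
  moreover have "T (step_graphon n w') \<le> T (step_graphon n w) + C * \<eta>"
    if n: "n > 0" and w: "\<And>i j. w i j \<in> prob_simplex" and w': "\<And>i j. w' i j \<in> prob_simplex"
      and close: "\<And>a. cut_close n (\<lambda>i j. (w' i j - w i j) $ a) (\<eta> * (real n)\<^sup>2)" for n w w' \<eta>
  proof -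
    have T_step: "T (step_graphon n w) = (\<Sum>i=1..n. \<Sum>j=1..n. c \<bullet> w i j) / (real n)\<^sup>2 +
        (\<Sum>s=1..R. \<gamma> s * discrete_density (V s) (E s) n (\<lambda>i j. \<alpha> s \<bullet> w i j))" for w
      using G n by (intro graphon_hamiltonian_step) auto
    have lin: "(\<Sum>i=1..n. \<Sum>j=1..n. c \<bullet> w' i j) / (real n)\<^sup>2 \<le> (\<Sum>i=1..n. \<Sum>j=1..n. c \<bullet> w i j) / (real n)\<^sup>2 + cs * \<eta>"
    proof -
      have "\<bar>\<Sum>i=1..n. \<Sum>j=1..n. c \<bullet> (w' i j - w i j)\<bar> \<le> cs * (\<eta> * (real n)\<^sup>2)"
        using cut_close_inner[OF close, of c] unfolding cut_close_def cs_def by blast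
      then have "(\<Sum>i=1..n. \<Sum>j=1..n. c \<bullet> w' i j) \<le> (\<Sum>i=1..n. \<Sum>j=1..n. c \<bullet> w i j) + cs * \<eta> * (real n)\<^sup>2"
        by (simp add: inner_diff_right sum_subtractf)
      then have "(\<Sum>i=1..n. \<Sum>j=1..n. c \<bullet> w' i j) / (real n)\<^sup>2
          \<le> ((\<Sum>i=1..n. \<Sum>j=1..n. c \<bullet> w i j) + cs * \<eta> * (real n)\<^sup>2) / (real n)\<^sup>2"
        by (rule divide_right_mono) simp
      then show ?thesis using n by (simp add: add_divide_distrib)
    qed
    have dens: "discrete_density (V s) (E s) n (\<lambda>i j. \<alpha> s \<bullet> w' i j) \<le> discrete_density (V s) (E s) n (\<lambda>i j. \<alpha> s \<bullet> w i j)
        + real (card (E s)) * M s ^ (card (E s) - 1) * (M s * \<eta>)" if s: "s \<in> {1..R}" for s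
    proof (rule discrete_density_le)
      show "simple_graph (V s) (E s)" using G[OF s] by simp
      fix A B :: "nat set" assume AB: "A \<subseteq> {1..n}" "B \<subseteq> {1..n}"
      have "\<bar>\<Sum>i\<in>A. \<Sum>j\<in>B. \<alpha> s \<bullet> (w' i j - w i j)\<bar> \<le> M s * (\<eta> * (real n)\<^sup>2)"
        using cut_close_inner[OF close, of "\<alpha> s"] AB unfolding cut_close_def M_def by blast
      then show "(\<Sum>i\<in>A. \<Sum>j\<in>B. \<alpha> s \<bullet> w' i j - \<alpha> s \<bullet> w i j) \<le> M s * \<eta> * (real n)\<^sup>2"
        by (simp add: inner_diff_right)
    next
      have "\<alpha> s \<bullet> \<mu> \<le> M s" if "\<mu> \<in> prob_simplex" for \<mu>
        using abs_inner_prob_simplex_le[OF that, of "\<alpha> s"] unfolding M_def by simp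
      then show "\<alpha> s \<bullet> w i j \<le> M s" "\<alpha> s \<bullet> w' i j \<le> M s" for i j
        using w w' by blast+
      show "0 \<le> \<alpha> s \<bullet> w i j" "0 \<le> \<alpha> s \<bullet> w' i j" for i j
        by (intro inner_prob_simplex_nonneg w w' \<alpha> s)+
    qed (use M0 n in auto)
    have "(\<Sum>s=1..R. \<gamma> s * discrete_density (V s) (E s) n (\<lambda>i j. \<alpha> s \<bullet> w' i j))
        \<le> (\<Sum>s=1..R. \<gamma> s * (discrete_density (V s) (E s) n (\<lambda>i j. \<alpha> s \<bullet> w i j)
        + real (card (E s)) * M s ^ (card (E s) - 1) * (M s * \<eta>)))"
      by (intro sum_mono mult_left_mono dens \<gamma>)
    also have "\<dots> = (\<Sum>s=1..R. \<gamma> s * discrete_density (V s) (E s) n (\<lambda>i j. \<alpha> s \<bullet> w i j))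
        + (\<Sum>s=1..R. \<gamma> s * (real (card (E s)) * M s ^ (card (E s) - 1) * M s)) * \<eta>"
      by (simp add: distrib_left sum.distrib sum_distrib_right mult.assoc)
    finally show ?thesis
      using lin unfolding T_step C_def distrib_right by linarith
  qed
  ultimately show ?thesis by (intro exI[of _ C]) simp
qed

text \<open>A set of colourings that are pairwise close in cut norm is compared with its mean: all its
  members have nearly the energy of the mean, and its cardinality is bounded by the entropy of the mean.\<close>

lemma sum_exp_cluster_le:
  assumes n: "n > 0" and \<A>: "\<A> \<subseteq> colorings n"
    and close: "\<And>X. X \<in> \<A> \<Longrightarrow> T (empirical_graphon n X) \<le> T (step_graphon n (mean_matrix n \<A>)) + \<delta>"
  shows "(\<Sum>X\<in>\<A>. exp ((real n)\<^sup>2 * T (empirical_graphon n X))) \<le> exp ((real n)\<^sup>2 * (S + \<delta>))"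
proof (cases "\<A> = {}")
  case False
  have fin: "finite \<A>" using \<A> finite_colorings finite_subset by blast
  let ?w = "step_graphon n (mean_matrix n \<A>)"
  have w: "?w \<in> graphons"
    by (intro step_graphon_in_graphons mean_matrix_sym mean_matrix_in_prob_simplex fin False)
  have pos: "real (card \<A>) > 0" using fin False by (simp add: card_gt_0_iff)
  have "(\<Sum>X\<in>\<A>. exp ((real n)\<^sup>2 * T (empirical_graphon n X))) \<le> (\<Sum>X\<in>\<A>. exp ((real n)\<^sup>2 * (T ?w + \<delta>)))"
    using close by (intro sum_mono) (simp add: mult_left_mono)
  also have "\<dots> = exp (ln (card \<A>) + (real n)\<^sup>2 * (T ?w + \<delta>))"
    using pos by (simp add: exp_add)
  also have "\<dots> \<le> exp ((real n)\<^sup>2 * (S + \<delta>))"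
  proof -
    \<comment> \<open>The number of members pays exactly the entropy term at the mean graphon,
      turning its energy into the functional bounded by \<open>S\<close>.\<close>
    have "ln (card \<A>) + (real n)\<^sup>2 * (T ?w + \<delta>) \<le> (real n)\<^sup>2 * (T ?w - 1 / 2 * graphon_entropy ?w + \<delta>)"
      using ln_card_colorings_le[OF \<A> False n] by (simp add: algebra_simps)
    also have "\<dots> \<le> (real n)\<^sup>2 * (S + \<delta>)"
      using hamiltonian_le_SUP[OF w] by (intro mult_left_mono add_right_mono) auto
    finally show ?thesis by simp
  qed
  finally show ?thesis .
qed simp

text \<open>A union bound over clusters: \<open>C * \<epsilon>\<close> is their diameter and the
  last term the logarithm of their number. \<open>N\<close> is tied to \<epsilon> but not to
  \<open>n\<close>, so the last term vanishes as n grows at fixed \<epsilon>.\<close>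

lemma free_energy_le:
  "\<exists>C\<ge>0. \<forall>\<epsilon>>0. \<forall>N n. real N * \<epsilon>\<^sup>2 > 1 \<longrightarrow> n > 0 \<longrightarrow>
    free_energy (graphon_hamiltonian c R \<gamma> \<alpha> V E) n
      \<le> (SUP \<mu>\<in>prob_simplex. scalar_functional c R \<gamma> \<alpha> E \<mu>) + C * \<epsilon> + 4 * real CARD('k) * real N / real n"
proof -
  obtain C where C: "C \<ge> 0" and
    lip: "\<forall>n>0. \<forall>w w' \<eta>. (\<forall>i j. w i j \<in> prob_simplex \<and> w' i j \<in> prob_simplex) \<longrightarrow>
      (\<forall>a. cut_close n (\<lambda>i j. (w' i j - w i j) $ a) (\<eta> * (real n)\<^sup>2)) \<longrightarrow>
      T (step_graphon n w') \<le> T (step_graphon n w) + C * \<eta>"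
    using hamiltonian_lipschitz by blast
  have "free_energy T n \<le> S + (2 * C) * \<epsilon> + 4 * real CARD('k) * real N / real n"
    if \<epsilon>: "\<epsilon> > 0" "real N * \<epsilon>\<^sup>2 > 1" and n: "n > 0" for \<epsilon> N n
  proof -
    obtain \<phi> :: "(nat set \<Rightarrow> 'k) \<Rightarrow> 'k \<Rightarrow> cut_code" where \<phi>: "\<And>X a. \<phi> X a \<in> cut_codes n N"
      and \<phi>_close: "\<And>X Y a. \<phi> X = \<phi> Y \<Longrightarrow>
        cut_close n (\<lambda>i j. empirical_matrix n X i j $ a - empirical_matrix n Y i j $ a) (2 * \<epsilon> * (real n)\<^sup>2)"
      using cut_codes_cover[OF \<epsilon> n] by blast
    let ?C = "colorings n :: (nat set \<Rightarrow> 'k) set"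
    let ?K = "(UNIV :: 'k set) \<rightarrow>\<^sub>E cut_codes n N"
    let ?t = "\<lambda>X. (real n)\<^sup>2 * T (empirical_graphon n X)"
    define b where "b = (real n)\<^sup>2 * (S + (2 * C) * \<epsilon>)"
    have finC: "finite ?C" by (rule finite_colorings)
    have finK: "finite ?K" using finite_cut_codes by (intro finite_PiE) auto
    have "(\<Sum>X\<in>?C. exp (?t X)) = (\<Sum>k\<in>?K. \<Sum>X\<in>{X \<in> ?C. \<phi> X = k}. exp (?t X))"
      using finC finK \<phi> by (intro sum.group[symmetric]) (auto simp: PiE_iff)
    also have "\<dots> \<le> (\<Sum>k\<in>?K. exp b)"
      unfolding b_def
    proof (intro sum_mono sum_exp_cluster_le n)
      fix k X assume X: "X \<in> {X \<in> ?C. \<phi> X = k}"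
      let ?A = "{X \<in> ?C. \<phi> X = k}"
      have A: "finite ?A" "?A \<noteq> {}" using X finC by auto
      \<comment> \<open>Members of a cluster are 2 \<epsilon> apart, which is where the constant
        \<open>2 * C\<close> comes from.\<close>
      have "T (step_graphon n (empirical_matrix n X)) \<le> T (step_graphon n (mean_matrix n ?A)) + C * (2 * \<epsilon>)"
        by (intro lip[rule_format] n conjI empirical_matrix_in_prob_simplex mean_matrix_in_prob_simplex A
            cut_close_mean_matrix \<phi>_close) (use X in auto)
      then show "T (empirical_graphon n X) \<le> T (step_graphon n (mean_matrix n ?A)) + 2 * C * \<epsilon>"
        by (simp add: empirical_graphon_eq_step mult_ac)
    qed auto
    also have "\<dots> = real (card ?K) * exp b" by simp
    finally have Z: "(\<Sum>X\<in>?C. exp (?t X)) \<le> real (card ?K) * exp b" .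
    have Zpos: "0 < (\<Sum>X\<in>?C. exp (?t X))"
      by (intro sum_pos finC colorings_nonempty) auto
    have cardK: "card ?K = ((3 * (2 ^ n * 2 ^ n)) ^ N) ^ CARD('k)"
      by (simp add: card_PiE card_cut_codes)
    have "ln (\<Sum>X\<in>?C. exp (?t X)) \<le> ln (real (card ?K) * exp b)"
      using Z Zpos by simp
    also have "\<dots> = ln (real (card ?K)) + b"
      by (subst ln_mult) (auto simp: cardK)
    also have "ln (real (card ?K)) = real CARD('k) * (real N * (ln 3 + 2 * real n * ln 2))"
      by (simp add: cardK ln_realpow ln_mult algebra_simps)
    also have "\<dots> \<le> real CARD('k) * (real N * (4 * real n))"
    proof (intro mult_left_mono)
      have "ln 3 \<le> (2::real)" "ln 2 \<le> (1::real)"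
        using ln_le_minus_one[of 3] ln_le_minus_one[of 2] by auto
      moreover have "2 * real n * ln 2 \<le> 2 * real n * 1"
        using \<open>ln 2 \<le> (1::real)\<close> by (intro mult_left_mono) auto
      moreover have "1 \<le> real n" using n by simp
      ultimately show "ln 3 + 2 * real n * ln 2 \<le> 4 * real n" by linarith
    qed auto
    finally have "ln (\<Sum>X\<in>?C. exp (?t X)) \<le> b + real CARD('k) * (real N * (4 * real n))" by simp
    then have "1 / (real n)\<^sup>2 * ln (\<Sum>X\<in>?C. exp (?t X)) \<le> 1 / (real n)\<^sup>2 * (b + real CARD('k) * (real N * (4 * real n)))"
      by (intro mult_left_mono) auto
    also have "\<dots> = S + (2 * C) * \<epsilon> + 4 * real CARD('k) * real N / real n"
      unfolding b_def using n by (simp add: distrib_left power2_eq_square)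
    finally show ?thesis unfolding free_energy_def .
  qed
  then show ?thesis using C by (intro exI[of _ "2 * C"]) simp
qed

lemma free_energy_tendsto:
  "free_energy (graphon_hamiltonian c R \<gamma> \<alpha> V E)
    \<longlonglongrightarrow> (SUP \<mu>\<in>prob_simplex. scalar_functional c R \<gamma> \<alpha> E \<mu>)"
proof (rule order_tendstoI)
  have small: "eventually (\<lambda>n. D / real n < \<delta>) sequentially" if "\<delta> > 0" for D \<delta> :: real
    using order_tendstoD(2)[OF lim_const_over_n[of D] that] .
  fix x assume x: "x < S"
  \<comment> \<open>A near-maximizer suffices; it is fixed before \<open>n\<close> because the error
    constant \<open>D\<close> depends on it.\<close>
  then obtain \<mu> where \<mu>: "\<mu> \<in> prob_simplex" "x < scalar_functional c R \<gamma> \<alpha> E \<mu>"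
    using uniform_in_prob_simplex bdd_above_scalar_functional by (subst (asm) less_cSUP_iff) auto
  obtain D where D: "\<And>n. n > 0 \<Longrightarrow> scalar_functional c R \<gamma> \<alpha> E \<mu> - D / real n \<le> free_energy T n"
    using free_energy_ge[of R V E \<alpha> \<gamma> \<mu> c] G \<alpha> \<gamma> \<mu>(1) by blast
  have "\<forall>\<^sub>F n in sequentially. D / real n < scalar_functional c R \<gamma> \<alpha> E \<mu> - x"
    using \<mu>(2) by (intro small) simp
  then show "\<forall>\<^sub>F n in sequentially. x < free_energy T n"
    using eventually_gt_at_top[of 0]
  proof eventually_elim
    case (elim n)
    then show ?case using D[of n] by linarith
  qed
next
  have small: "eventually (\<lambda>n. D / real n < \<delta>) sequentially" if "\<delta> > 0" for D \<delta> :: real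
    using order_tendstoD(2)[OF lim_const_over_n[of D] that] .
  fix x assume x: "S < x"
  obtain C where C: "C \<ge> 0" and
    le: "\<forall>\<epsilon>>0. \<forall>N n. real N * \<epsilon>\<^sup>2 > 1 \<longrightarrow> n > 0 \<longrightarrow>
      free_energy T n \<le> S + C * \<epsilon> + 4 * real CARD('k) * real N / real n"
    using free_energy_le by blast
  \<comment> \<open>Half of the margin \<open>x - S\<close> is spent on the diameter and half on the
    number of clusters; \<open>C + 1\<close> avoids division by 0.\<close>
  define \<epsilon> where "\<epsilon> = (x - S) / (2 * (C + 1))"
  have \<epsilon>: "\<epsilon> > 0" unfolding \<epsilon>_def using x C by simp
  have "C * \<epsilon> < (C + 1) * \<epsilon>" using \<epsilon> by simp
  also have "(C + 1) * \<epsilon> = (x - S) / 2" unfolding \<epsilon>_def using C by (simp add: field_simps)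
  finally have C\<epsilon>: "C * \<epsilon> < (x - S) / 2" .
  obtain N :: nat where "1 / \<epsilon>\<^sup>2 < real N" using reals_Archimedean2 by blast
  then have N: "real N * \<epsilon>\<^sup>2 > 1" using \<epsilon> by (simp add: field_simps)
  have "\<forall>\<^sub>F n in sequentially. 4 * real CARD('k) * real N / real n < (x - S) / 2"
    using x by (intro small) simp
  then show "\<forall>\<^sub>F n in sequentially. free_energy T n < x"
    using eventually_gt_at_top[of 0]
  proof eventually_elim
    case (elim n)
    have "S + y + z < x" if "y < (x - S) / 2" "z < (x - S) / 2" for y z
      using that by (simp add: field_simps)
    from this[OF C\<epsilon> elim(1)] show ?case using le[rule_format, OF \<epsilon> N elim(2)] by linarith
  qed
qed

end

theorem theorem3p8:
  fixes c :: "real ^ 'k::finite"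
    and R :: nat
    and \<gamma> :: "nat \<Rightarrow> real"
    and \<alpha> :: "nat \<Rightarrow> real ^ 'k"
    and V :: "nat \<Rightarrow> 'v::linorder set"
    and E :: "nat \<Rightarrow> 'v set set"
  assumes "CARD('k) \<ge> 2"
    and "\<And>s. s \<in> {1..R} \<Longrightarrow> simple_graph (V s) (E s) \<and> E s \<noteq> {}"
    and "\<And>s a. s \<in> {1..R} \<Longrightarrow> \<alpha> s $ a \<ge> 0"
    and "\<And>s. s \<in> {1..R} \<Longrightarrow> \<gamma> s \<ge> 0"
  shows "free_energy (graphon_hamiltonian c R \<gamma> \<alpha> V E)
           \<longlonglongrightarrow> (SUP \<mu>\<in>prob_simplex. scalar_functional c R \<gamma> \<alpha> E \<mu>) \<and>
         (\<forall>W. is_arg_max (\<lambda>W. graphon_hamiltonian c R \<gamma> \<alpha> V E W - 1 / 2 * graphon_entropy W)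
               (\<lambda>W. W \<in> graphons) W \<longrightarrow>
           (\<exists>\<mu>\<in>prob_simplex.
              scalar_functional c R \<gamma> \<alpha> E \<mu> = (SUP \<nu>\<in>prob_simplex. scalar_functional c R \<gamma> \<alpha> E \<nu>) \<and>
              (AE p in (unit_lborel \<Otimes>\<^sub>M unit_lborel). W p = \<mu>)))"
proof (intro conjI allI impI)
  show "free_energy (graphon_hamiltonian c R \<gamma> \<alpha> V E)
      \<longlonglongrightarrow> (SUP \<mu>\<in>prob_simplex. scalar_functional c R \<gamma> \<alpha> E \<mu>)"
    by (rule free_energy_tendsto) (use assms in auto)
  show "\<exists>\<mu>\<in>prob_simplex.
      scalar_functional c R \<gamma> \<alpha> E \<mu> = (SUP \<nu>\<in>prob_simplex. scalar_functional c R \<gamma> \<alpha> E \<nu>) \<and>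
      (AE p in (unit_lborel \<Otimes>\<^sub>M unit_lborel). W p = \<mu>)"
    if "is_arg_max (\<lambda>W. graphon_hamiltonian c R \<gamma> \<alpha> V E W - 1 / 2 * graphon_entropy W) (\<lambda>W. W \<in> graphons) W" for W
    by (rule maximizer_constant[OF _ _ _ that]) (use assms in auto)
qed

end
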